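(* Let $\mathbb{K}$ be a field and $d$ a nonnegative integer. Let $\{\theta_i\}_{i=0}^d$, $\{\theta^*_i\}_{i=0}^d$, $\{\varphi_i\}_{i=1}^d$ be scalars in $\mathbb{K}$ with $\theta_i\ne\theta_j$, $\theta^*_i\neq\theta^*_j$ if $i\ne j$ $(0\le i,j\le d)$, and $\varphi_i\ne0$ $(1\le i\le d)$. Let $A\in\mathrm{Mat}_{d+1}(\mathbb{K})$ be the lower bidiagonal matrix with $(i,i)$ entry $\theta_i$ $(0\le i\le d)$, $(i,i-1)$ entry $1$ $(1\le i\le d)$ and all other entries $0$; let $A^*\in\mathrm{Mat}_{d+1}(\mathbb{K})$ be the upper bidiagonal matrix with $(i,i)$ entry $\theta^*_i$ $(0\le i\le d)$, $(i-1,i)$ entry $\varphi_i$ $(1\le i\le d)$ and all other entries $0$. For $0\le i\le d$ let $E_i$ (resp. $E^*_i$) denote the primitive idempotent of $A$ (resp. $A^*$) associated with $\theta_i$ (resp. $\theta^*_i$). Then the following (i), (ii) are equivalent. (i) The pair $A,A^*$ is a Leonard pair. (ii) There exist an invertible $X\in\mathrm{Mat}_{d+1}(\mathbb{K})$ and nonzero scalars $\phi_i\in\mathbb{K}$ $(1\le i\le d)$ such that $X^{-1}AX=A$ and $X^{-1}A^*X$ is the upper bidiagonal matrix with $(i,i)$ entry $\theta^*_{d-i}$ $(0\le i\le d)$, $(i-1,i)$ entry $\phi_{d-i+1}$ $(1\le i\le d)$ and all other entries $0$. Suppose (i), (ii) hold. Then $\Phi=(A;\{E_i\}_{i=0}^d;A^*;\{E^*_i\}_{i=0}^d)$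 is a Leonard system, $\{\phi_i\}_{i=1}^d$ is the second split sequence of $\Phi$, and $X$ is a scalar multiple of the switching element for $\Phi$.
   Context: Rows and columns of matrices in $\mathrm{Mat}_{d+1}(\mathbb{K})$ are indexed by $0,1,\ldots,d$. The symbol $A^*$ is just a name for a second element (not a conjugate transpose). A square tridiagonal matrix is irreducible if every entry on the subdiagonal and on the superdiagonal is nonzero. A Leonard pair on a finite-dimensional nonzero $\mathbb{K}$-vector space $V$ is an ordered pair of linear maps $A,A^*:V\to V$ such that (a) there is a basis of $V$ with respect to which the matrix of $A$ is irreducible tridiagonal and the matrix of $A^*$ is diagonal; and (b) there is a basis of $V$ with respect to which the matrix of $A^*$ is irreducible tridiagonal and the matrix of $A$ is diagonal. Matrices in $\mathrm{Mat}_{d+1}(\mathbb{K})$ form a Leonard pair if they do so acting on $V=\mathbb{K}^{d+1}$. An element $A$ of $\mathcal{A}=\mathrm{Mat}_{d+1}(\mathbb{K})$ is multiplicity-free if it has $d+1$ mutually distinct eigenvalues in $\mathbb{K}$; for an ordering $\{\theta_i\}_{i=0}^d$ of these eigenvalues, the primitive idempotent of $A$ associated with $\theta_i$ is $E_i=\prod_{0\le j\le d,\,j\ne i}\frac{A-\theta_jI}{\theta_i-\theta_j}$. A Leonard system in $\mathcal{A}$ is a sequence $\Phi=(A;\{E_i\}_{i=0}^d;A^*;\{E^*_i\}_{i=0}^d)$ such that $A,A^*\in\mathcal{A}$ are multiplicity-free; $\{E_i\}_{i=0}^d$ (resp. $\{E^*_i\}_{i=0}^d$) is an ordering of the primitive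 idempotents of $A$ (resp. $A^*$); and for $0\le i,j\le d$ both $E_iA^*E_j$ and $E^*_iAE^*_j$ are zero if $|i-j|>1$ and nonzero if $|i-j|=1$. Let $\theta_i$ (resp. $\theta^*_i$) be the eigenvalue of $A$ (resp. $A^*$) associated with $E_i$ (resp. $E^*_i$). Put $\tau_i=(\lambda-\theta_0)\cdots(\lambda-\theta_{i-1})$ and $\eta_i=(\lambda-\theta_d)(\lambda-\theta_{d-1})\cdots(\lambda-\theta_{d-i+1})$ for $0\le i\le d$. For a Leonard system $\Phi$ the first split sequence is $\frac{(\theta^*_0-\theta^*_i)\mathrm{tr}(\tau_i(A)E^*_0)}{\mathrm{tr}(\tau_{i-1}(A)E^*_0)}$ $(1\le i\le d)$ and the second split sequence is $\frac{(\theta^*_0-\theta^*_i)\mathrm{tr}(\eta_i(A)E^*_0)}{\mathrm{tr}(\eta_{i-1}(A)E^*_0)}$ $(1\le i\le d)$ (the denominators, and all terms of both sequences, are known to be nonzero). If these sequences are denoted $\{\varphi_i\}_{i=1}^d$ and $\{\phi_i\}_{i=1}^d$ respectively, the switching element for $\Phi$ is $S=\sum_{r=0}^d\frac{\phi_d\phi_{d-1}\cdots\phi_{d-r+1}}{\varphi_1\varphi_2\cdots\varphi_r}E_r$. (For $A,A^*$ as in the claim forming a Leonard pair, the superdiagonal entries $\varphi_i$ of $A^*$ are known to coincide with the first split sequence of $\Phi$.) *)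

theory Defs
  imports "Jordan_Normal_Form.VS_Connect" "Jordan_Normal_Form.Char_Poly"
begin

text \<open>
  Throughout, \<open>d\<close> is a natural number, matrices live in \<open>carrier_mat (d+1) (d+1)\<close>
  with indices \<open>0, \<dots>, d\<close>, and a finite sequence of scalars or of matrices is a function on
  \<open>nat\<close> of which only the values at \<open>0, \<dots>, d\<close> (or \<open>1, \<dots>, d\<close>) are used.
\<close>

definition mat_trace :: "'a::comm_monoid_add mat \<Rightarrow> 'a" where
  "mat_trace M = (\<Sum>i<dim_row M. M $$ (i,i))"

definition mat_prod_list :: "nat \<Rightarrow> 'a::semiring_1 mat list \<Rightarrow> 'a mat" where
  "mat_prod_list n Ms = foldr (*) Ms (1\<^sub>m n)"

definition mat_lincomb :: "nat \<Rightarrow> (nat \<Rightarrow> 'a::comm_semiring_1) \<Rightarrow> (nat \<Rightarrow> 'a mat) \<Rightarrow> nat set \<Rightarrow> 'a mat" where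
  "mat_lincomb n c M R = mat n n (\<lambda>(i,j). \<Sum>r\<in>R. c r * M r $$ (i,j))"

definition poly_at_mat :: "'a::field poly \<Rightarrow> 'a mat \<Rightarrow> 'a mat" where
  "poly_at_mat p A = mat_lincomb (dim_row A) (coeff p) (\<lambda>k. A ^\<^sub>m k) {..degree p}"

subsection \<open>Leonard pairs\<close>

definition irreducible_tridiagonal :: "nat \<Rightarrow> 'a::zero mat \<Rightarrow> bool" where
  "irreducible_tridiagonal n B \<longleftrightarrow> B \<in> carrier_mat n n \<and>
     (\<forall>i<n. \<forall>j<n. \<bar>int i - int j\<bar> > 1 \<longrightarrow> B $$ (i,j) = 0) \<and>
     (\<forall>i<n. \<forall>j<n. \<bar>int i - int j\<bar> = 1 \<longrightarrow> B $$ (i,j) \<noteq> 0)"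

definition ordered_basis :: "nat \<Rightarrow> 'a::field vec list \<Rightarrow> bool" where
  "ordered_basis n vs \<longleftrightarrow> length vs = n \<and> distinct vs \<and>
     vectorspace.basis class_ring (module_vec TYPE('a) n) (set vs)"

text \<open>Column \<open>j\<close> of the equation below reads
  \<open>A v\<^sub>j = (\<Sum>i. B\<^sub>i\<^sub>j v\<^sub>i)\<close>, i.e. \<open>B\<close> represents the map \<open>v \<mapsto> A v\<close> in the basis \<open>vs\<close>.\<close>

definition represents :: "nat \<Rightarrow> 'a::field vec list \<Rightarrow> 'a mat \<Rightarrow> 'a mat \<Rightarrow> bool" where
  "represents n vs A B \<longleftrightarrow> B \<in> carrier_mat n n \<and> A * mat_of_cols n vs = mat_of_cols n vs * B"

definition leonard_pair :: "nat \<Rightarrow> 'a::field mat \<Rightarrow> 'a mat \<Rightarrow> bool" where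
  "leonard_pair d A As \<longleftrightarrow>
     A \<in> carrier_mat (d+1) (d+1) \<and> As \<in> carrier_mat (d+1) (d+1) \<and>
     (\<exists>vs B D. ordered_basis (d+1) vs \<and>
        represents (d+1) vs A B \<and> irreducible_tridiagonal (d+1) B \<and>
        represents (d+1) vs As D \<and> diagonal_mat D) \<and>
     (\<exists>vs B D. ordered_basis (d+1) vs \<and>
        represents (d+1) vs As B \<and> irreducible_tridiagonal (d+1) B \<and>
        represents (d+1) vs A D \<and> diagonal_mat D)"

subsection \<open>Leonard systems\<close>

definition multiplicity_free :: "nat \<Rightarrow> 'a::field mat \<Rightarrow> bool" where
  "multiplicity_free d A \<longleftrightarrow> A \<in> carrier_mat (d+1) (d+1) \<and> card {t. eigenvalue A t} = d + 1"

definition eigenvalue_ordering :: "nat \<Rightarrow> 'a::field mat \<Rightarrow> (nat \<Rightarrow> 'a) \<Rightarrow> bool" where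
  "eigenvalue_ordering d A \<theta> \<longleftrightarrow> bij_betw \<theta> {..d} {t. eigenvalue A t}"

definition primitive_idempotent :: "nat \<Rightarrow> 'a::field mat \<Rightarrow> (nat \<Rightarrow> 'a) \<Rightarrow> nat \<Rightarrow> 'a mat" where
  "primitive_idempotent d A \<theta> i = mat_prod_list (d+1)
     (map (\<lambda>j. (1 / (\<theta> i - \<theta> j)) \<cdot>\<^sub>m (A - \<theta> j \<cdot>\<^sub>m 1\<^sub>m (d+1))) (filter (\<lambda>j. j \<noteq> i) [0..<d+1]))"

definition idempotent_ordering :: "nat \<Rightarrow> 'a::field mat \<Rightarrow> (nat \<Rightarrow> 'a mat) \<Rightarrow> bool" where
  "idempotent_ordering d A E \<longleftrightarrow>
     (\<exists>\<theta>. eigenvalue_ordering d A \<theta> \<and> (\<forall>i\<le>d. E i = primitive_idempotent d A \<theta> i))"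

text \<open>The eigenvalue of the multiplicity-free matrix \<open>A\<close> whose primitive idempotent is \<open>F\<close>.\<close>

definition idempotent_eigenvalue :: "nat \<Rightarrow> 'a::field mat \<Rightarrow> 'a mat \<Rightarrow> 'a" where
  "idempotent_eigenvalue d A F =
     (THE t. \<exists>\<theta> i. eigenvalue_ordering d A \<theta> \<and> i \<le> d \<and> t = \<theta> i \<and> F = primitive_idempotent d A \<theta> i)"

type_synonym 'a leonard_data = "'a mat \<times> (nat \<Rightarrow> 'a mat) \<times> 'a mat \<times> (nat \<Rightarrow> 'a mat)"

fun leonard_system :: "nat \<Rightarrow> 'a::field leonard_data \<Rightarrow> bool" where
  "leonard_system d (A, E, As, Es) \<longleftrightarrow>
     multiplicity_free d A \<and> multiplicity_free d As \<and>
     idempotent_ordering d A E \<and> idempotent_ordering d As Es \<and>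
     (\<forall>i\<le>d. \<forall>j\<le>d.
        (\<bar>int i - int j\<bar> > 1 \<longrightarrow>
           E i * As * E j = 0\<^sub>m (d+1) (d+1) \<and> Es i * A * Es j = 0\<^sub>m (d+1) (d+1)) \<and>
        (\<bar>int i - int j\<bar> = 1 \<longrightarrow>
           E i * As * E j \<noteq> 0\<^sub>m (d+1) (d+1) \<and> Es i * A * Es j \<noteq> 0\<^sub>m (d+1) (d+1)))"

fun eigenvalue_seq :: "nat \<Rightarrow> 'a::field leonard_data \<Rightarrow> nat \<Rightarrow> 'a" where
  "eigenvalue_seq d (A, E, As, Es) i = idempotent_eigenvalue d A (E i)"

fun dual_eigenvalue_seq :: "nat \<Rightarrow> 'a::field leonard_data \<Rightarrow> nat \<Rightarrow> 'a" where
  "dual_eigenvalue_seq d (A, E, As, Es) i = idempotent_eigenvalue d As (Es i)"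

definition tau :: "(nat \<Rightarrow> 'a::field) \<Rightarrow> nat \<Rightarrow> 'a poly" where
  "tau \<theta> i = (\<Prod>h<i. [:- \<theta> h, 1:])"

definition eta :: "nat \<Rightarrow> (nat \<Rightarrow> 'a::field) \<Rightarrow> nat \<Rightarrow> 'a poly" where
  "eta d \<theta> i = (\<Prod>h<i. [:- \<theta> (d - h), 1:])"

fun first_split_seq :: "nat \<Rightarrow> 'a::field leonard_data \<Rightarrow> nat \<Rightarrow> 'a" where
  "first_split_seq d (A, E, As, Es) i =
     (let \<theta> = eigenvalue_seq d (A, E, As, Es); \<theta>s = dual_eigenvalue_seq d (A, E, As, Es) in
      (\<theta>s 0 - \<theta>s i) * mat_trace (poly_at_mat (tau \<theta> i) A * Es 0)
        / mat_trace (poly_at_mat (tau \<theta> (i - 1)) A * Es 0))"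

fun second_split_seq :: "nat \<Rightarrow> 'a::field leonard_data \<Rightarrow> nat \<Rightarrow> 'a" where
  "second_split_seq d (A, E, As, Es) i =
     (let \<theta> = eigenvalue_seq d (A, E, As, Es); \<theta>s = dual_eigenvalue_seq d (A, E, As, Es) in
      (\<theta>s 0 - \<theta>s i) * mat_trace (poly_at_mat (eta d \<theta> i) A * Es 0)
        / mat_trace (poly_at_mat (eta d \<theta> (i - 1)) A * Es 0))"

fun switching_element :: "nat \<Rightarrow> 'a::field leonard_data \<Rightarrow> 'a mat" where
  "switching_element d (A, E, As, Es) =
     (let vphi = first_split_seq d (A, E, As, Es); phi = second_split_seq d (A, E, As, Es) in
      mat_lincomb (d+1) (\<lambda>r. (\<Prod>h=1..r. phi (d - h + 1)) / (\<Prod>h=1..r. vphi h)) E {..d})"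

subsection \<open>Bidiagonal matrices\<close>

definition lower_bidiagonal :: "nat \<Rightarrow> (nat \<Rightarrow> 'a::field) \<Rightarrow> 'a mat" where
  "lower_bidiagonal d a = mat (d+1) (d+1)
     (\<lambda>(i,j). if i = j then a i else if i = j + 1 then 1 else 0)"

text \<open>The entry in position \<open>(i - 1, i)\<close> is \<open>b i\<close>, for \<open>1 \<le> i \<le> d\<close>.\<close>

definition upper_bidiagonal :: "nat \<Rightarrow> (nat \<Rightarrow> 'a::field) \<Rightarrow> (nat \<Rightarrow> 'a) \<Rightarrow> 'a mat" where
  "upper_bidiagonal d a b = mat (d+1) (d+1)
     (\<lambda>(i,j). if i = j then a i else if j = i + 1 then b j else 0)"

text \<open>Here \<open>Y = X\<^sup>-\<^sup>1\<close>.\<close>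

definition reverses_bidiagonal ::
    "nat \<Rightarrow> 'a::field mat \<Rightarrow> 'a mat \<Rightarrow> (nat \<Rightarrow> 'a) \<Rightarrow> 'a mat \<Rightarrow> (nat \<Rightarrow> 'a) \<Rightarrow> bool" where
  "reverses_bidiagonal d A As \<theta>s X phi \<longleftrightarrow>
     X \<in> carrier_mat (d+1) (d+1) \<and> (\<forall>i\<in>{1..d}. phi i \<noteq> 0) \<and>
     (\<exists>Y \<in> carrier_mat (d+1) (d+1). inverts_mat X Y \<and> inverts_mat Y X \<and>
        Y * A * X = A \<and>
        Y * As * X = upper_bidiagonal d (\<lambda>i. \<theta>s (d - i)) (\<lambda>i. phi (d - i + 1)))"

end

theory Submission
  imports Defs "Jordan_Normal_Form.DL_Rank"
begin

text \<open>
  The pair \<open>A, As\<close> is studied through two matrices: \<open>T\<close>, which is \<open>A\<close> written in the eigenbasis of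
  \<open>As\<close>, and \<open>H\<close>, which is \<open>As\<close> written in the eigenbasis of \<open>A\<close>, with the eigenvalues in the given
  order. Bidiagonality already gives half of what a Leonard pair needs: \<open>T\<close> vanishes below its
  subdiagonal, \<open>H\<close> vanishes above its superdiagonal, and these two diagonals have no zero
  (\<open>T_hessenberg\<close>, \<open>H_hessenberg\<close>). Both conditions of the theorem turn out to say that \<open>T\<close> is
  irreducible tridiagonal.

  If \<open>A, As\<close> is a Leonard pair, then \<open>T\<close> is irreducible tridiagonal after some permutation of the
  eigenvalues, and the nonzero subdiagonal of \<open>T\<close> forces this permutation to be the identity or the
  reversal (\<open>irreducible_T_of_leonard_pair\<close>). Conversely, an irreducible tridiagonal \<open>T\<close> is
  symmetrized by a diagonal matrix. This yields a nondegenerate symmetric form for which \<open>A\<close> and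
  \<open>As\<close> are self-adjoint, hence the zero pattern of \<open>H\<close> is symmetric, and the known half of \<open>H\<close>
  determines the other half (\<open>eigenbasis_pattern_symmetric\<close>). So \<open>T\<close> alone decides.

  An \<open>X\<close> as in the second condition conjugates the pair to a split form with the same \<open>A\<close> and with
  the dual eigenvalues reversed. That form gives the missing upper half of \<open>T\<close>
  (\<open>irreducible_T_of_reverses\<close>). Conversely, if \<open>T\<close> is irreducible tridiagonal, the columns
  \<open>\<tau>\<^sub>i(A) v\<close>, for \<open>v\<close> an eigenvector of \<open>As\<close> for the last dual eigenvalue, form such an \<open>X\<close>
  (\<open>ex_reverses_of_irreducible_T\<close>).

  The idempotent \<open>Es 0\<close> is \<open>e\<^sub>0 w\<^sup>T\<close> with \<open>w\<close> a left eigenvector of \<open>As\<close>, so the traces in the split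
  sequences are single entries that obey two-term recursions with coefficients \<open>vphi\<close> and, after
  conjugation by \<open>X\<close>, \<open>phi\<close> (\<open>first_split_seq_eq\<close>, \<open>second_split_seq_eq\<close>). Finally \<open>X\<close> is a lower
  triangular element of the algebra generated by \<open>A\<close>, and the superdiagonal of the equation
  \<open>As X = X (X\<^sup>-\<^sup>1 As X)\<close> determines its eigenvalues up to a common factor
  (\<open>X_eq_switching_element\<close>).
\<close>

section \<open>Triangular and bidiagonal matrices\<close>

lemma mat_mult_entry:
  assumes "M \<in> carrier_mat n m" "N \<in> carrier_mat m l" "i < n" "j < l"
  shows "(M * N) $$ (i,j) = (\<Sum>k<m. M $$ (i,k) * N $$ (k,j))"
  using assms by (auto simp: scalar_prod_def lessThan_atLeast0)

(* The default rule turns entries of products into scalar products of rows and columns, which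
   would hide them from the entrywise lemmas below. *)
declare index_mult_mat(1) [simp del]

text \<open>
  Forward substitution, column by column: it transports the position of the first nonzero entry of
  a column through a lower triangular change of basis, so that statements about flags become
  statements about zero patterns and no inverse ever has to be written down.
\<close>

lemma lower_triangular_solve:
  fixes Q S :: "'a::field mat"
  assumes Q: "Q \<in> carrier_mat n n" and S: "S \<in> carrier_mat n n"
    and low: "\<And>i j. i < j \<Longrightarrow> j < n \<Longrightarrow> Q $$ (i,j) = 0"
    and diag: "\<And>i. i < n \<Longrightarrow> Q $$ (i,i) \<noteq> 0"
    and j: "j < n" and m: "m < n"
    and zero: "\<And>i. i < m \<Longrightarrow> (Q * S) $$ (i,j) = 0"
  shows "i < m \<Longrightarrow> S $$ (i,j) = 0" and "(Q * S) $$ (m,j) = Q $$ (m,m) * S $$ (m,j)"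
proof -
  have row: "(Q * S) $$ (i,j) = Q $$ (i,i) * S $$ (i,j)"
    if i: "i < n" and above: "\<And>k. k < i \<Longrightarrow> S $$ (k,j) = 0" for i
  proof -
    have "(Q * S) $$ (i,j) = (\<Sum>k<n. Q $$ (i,k) * S $$ (k,j))"
      using Q S i j by (rule mat_mult_entry)
    also have "\<dots> = (\<Sum>k\<in>{i}. Q $$ (i,k) * S $$ (k,j))"
    proof (rule sum.mono_neutral_right)
      show "\<forall>k\<in>{..<n} - {i}. Q $$ (i,k) * S $$ (k,j) = 0"
      proof
        fix k assume "k \<in> {..<n} - {i}"
        then show "Q $$ (i,k) * S $$ (k,j) = 0"
          using low[of i k] above[of k] by (cases "k < i") auto
      qed
    qed (use i in auto)
    finally show ?thesis by simp
  qed
  have above: "i < m \<Longrightarrow> S $$ (i,j) = 0" for i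
  proof (induction i rule: less_induct)
    case (less i)
    then have "Q $$ (i,i) * S $$ (i,j) = 0"
      using row[of i] zero[of i] m by simp
    then show ?case using diag[of i] less.prems m by simp
  qed
  then show "i < m \<Longrightarrow> S $$ (i,j) = 0" .
  show "(Q * S) $$ (m,j) = Q $$ (m,m) * S $$ (m,j)"
    using row[OF m above] .
qed

lemma lower_triangular_mult:
  fixes M N :: "'a::field mat"
  assumes M: "M \<in> carrier_mat n n" and N: "N \<in> carrier_mat n n"
    and lowM: "\<And>i j. i < j \<Longrightarrow> j < n \<Longrightarrow> M $$ (i,j) = 0"
    and lowN: "\<And>i j. i < j \<Longrightarrow> j < n \<Longrightarrow> N $$ (i,j) = 0"
  shows "i < j \<Longrightarrow> j < n \<Longrightarrow> (M * N) $$ (i,j) = 0"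
    and "i < n \<Longrightarrow> (M * N) $$ (i,i) = M $$ (i,i) * N $$ (i,i)"
proof -
  have *: "M $$ (i,k) * N $$ (k,j) = 0" if "k < n" "j < n" "i < j \<or> (i = j \<and> k \<noteq> i)" for i j k
    using that lowM[of i k] lowN[of k j] by (cases "k \<le> i") auto
  show "i < j \<Longrightarrow> j < n \<Longrightarrow> (M * N) $$ (i,j) = 0"
    using * by (subst mat_mult_entry[OF M N]) (auto intro: sum.neutral)
  assume i: "i < n"
  have "(\<Sum>k<n. M $$ (i,k) * N $$ (k,i)) = (\<Sum>k\<in>{i}. M $$ (i,k) * N $$ (k,i))"
    by (rule sum.mono_neutral_right) (use i * in auto)
  then show "(M * N) $$ (i,i) = M $$ (i,i) * N $$ (i,i)"
    using i by (simp add: mat_mult_entry[OF M N])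
qed

lemma ex_inverse_of_det_nonzero:
  fixes M :: "'a::field mat"
  assumes M: "M \<in> carrier_mat n n" and det: "det M \<noteq> 0"
  obtains N where "N \<in> carrier_mat n n" "M * N = 1\<^sub>m n" "N * M = 1\<^sub>m n"
  using det_non_zero_imp_unit[OF M det, of undefined]
  unfolding Units_def ring_mat_def by auto

lemma det_lower_triangular_nonzero:
  fixes M :: "'a::field mat"
  assumes M: "M \<in> carrier_mat n n"
    and low: "\<And>i j. i < j \<Longrightarrow> j < n \<Longrightarrow> M $$ (i,j) = 0"
    and diag: "\<And>i. i < n \<Longrightarrow> M $$ (i,i) \<noteq> 0"
  shows "det M \<noteq> 0"
  using det_lower_triangular[OF low M] diag M by (auto simp: prod_list_zero_iff diag_mat_def)

lemma transpose_similar_mat_wit: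
  fixes M :: "'a::comm_semiring_1 mat"
  assumes "similar_mat_wit M D Q Qi"
  shows "similar_mat_wit M\<^sup>T D\<^sup>T Qi\<^sup>T Q\<^sup>T"
proof -
  obtain n where n: "n = dim_row M" by simp
  note w = similar_mat_witD[OF n assms]
  show ?thesis
  proof (rule similar_mat_witI[of _ _ n])
    show "Qi\<^sup>T * Q\<^sup>T = 1\<^sub>m n" "Q\<^sup>T * Qi\<^sup>T = 1\<^sub>m n"
      using w(1,2) by (simp_all flip: transpose_mult[OF w(6,7)] transpose_mult[OF w(7,6)])
    show "M\<^sup>T = Qi\<^sup>T * D\<^sup>T * Q\<^sup>T"
      using w by (simp add: transpose_mult[of _ n n _ n] assoc_mult_mat[of _ n n _ n _ n])
  qed (use w in auto)
qed

lemma transpose_mat_diag [simp]: "(mat_diag n f)\<^sup>T = mat_diag n f"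
  by (rule eq_matI) (auto simp: mat_diag_def)

lemma mat_diag_entry [simp]:
  "i < n \<Longrightarrow> j < n \<Longrightarrow> mat_diag n f $$ (i,j) = (if i = j then f j else 0)"
  by (simp add: mat_diag_def)

lemma mat_diag_mult_left_entry:
  "M \<in> carrier_mat n m \<Longrightarrow> i < n \<Longrightarrow> j < m \<Longrightarrow> (mat_diag n f * M) $$ (i,j) = f i * M $$ (i,j)"
  by (simp add: mat_diag_mult_left)

lemma mat_diag_mult_right_entry:
  "M \<in> carrier_mat m n \<Longrightarrow> i < m \<Longrightarrow> j < n \<Longrightarrow> (M * mat_diag n f) $$ (i,j) = M $$ (i,j) * f j"
  by (simp add: mat_diag_mult_right)

lemma bidiagonal_carrier [simp]:
  "upper_bidiagonal d a b \<in> carrier_mat (Suc d) (Suc d)"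
  "lower_bidiagonal d a \<in> carrier_mat (Suc d) (Suc d)"
  "dim_row (upper_bidiagonal d a b) = Suc d" "dim_col (upper_bidiagonal d a b) = Suc d"
  by (simp_all add: upper_bidiagonal_def lower_bidiagonal_def)

lemma upper_bidiagonal_entry:
  "i \<le> d \<Longrightarrow> j \<le> d \<Longrightarrow> upper_bidiagonal d a b $$ (i,j) =
    (if i = j then a i else if j = i + 1 then b j else 0)"
  by (simp add: upper_bidiagonal_def)

lemma transpose_lower_bidiagonal: "(lower_bidiagonal d a)\<^sup>T = upper_bidiagonal d a (\<lambda>_. 1)"
  by (rule eq_matI) (auto simp: lower_bidiagonal_def upper_bidiagonal_def)

lemma lower_bidiagonal_eq_transpose: "lower_bidiagonal d a = (upper_bidiagonal d a (\<lambda>_. 1))\<^sup>T"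
  by (metis transpose_lower_bidiagonal transpose_transpose)

lemma sum_two_neighbours:
  fixes f :: "nat \<Rightarrow> 'a::comm_monoid_add"
  assumes "i \<le> d" "\<And>k. k \<le> d \<Longrightarrow> k \<noteq> i \<Longrightarrow> k \<noteq> i + 1 \<Longrightarrow> f k = 0"
  shows "(\<Sum>k<d+1. f k) = f i + (if i + 1 \<le> d then f (i+1) else 0)"
proof -
  have "(\<Sum>k<d+1. f k) = (\<Sum>k\<in>{i} \<union> (if i + 1 \<le> d then {i+1} else {}). f k)"
    by (rule sum.mono_neutral_right) (use assms in \<open>auto split: if_splits\<close>)
  also have "\<dots> = f i + (if i + 1 \<le> d then f (i+1) else 0)" by simp
  finally show ?thesis .
qed

lemma upper_bidiagonal_mult_left:
  fixes M :: "'a::field mat"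
  assumes "M \<in> carrier_mat (d+1) (d+1)" "i \<le> d" "j \<le> d"
  shows "(upper_bidiagonal d a b * M) $$ (i,j) =
    a i * M $$ (i,j) + (if i + 1 \<le> d then b (i+1) * M $$ (i+1,j) else 0)"
proof -
  have "(upper_bidiagonal d a b * M) $$ (i,j) = (\<Sum>k<d+1. upper_bidiagonal d a b $$ (i,k) * M $$ (k,j))"
    using assms by (intro mat_mult_entry[of _ "d+1" _ _ "d+1"]) auto
  also have "\<dots> = upper_bidiagonal d a b $$ (i,i) * M $$ (i,j) +
      (if i + 1 \<le> d then upper_bidiagonal d a b $$ (i,i+1) * M $$ (i+1,j) else 0)"
    using assms by (intro sum_two_neighbours) (auto simp: upper_bidiagonal_entry)
  finally show ?thesis using assms by (auto simp: upper_bidiagonal_entry)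
qed

lemma upper_bidiagonal_mult_right:
  fixes M :: "'a::field mat"
  assumes M: "M \<in> carrier_mat (d+1) (d+1)" and i: "i \<le> d" and j: "j \<le> d"
  shows "(M * upper_bidiagonal d a b) $$ (i,j) =
    M $$ (i,j) * a j + (if 0 < j then M $$ (i,j-1) * b j else 0)"
proof -
  let ?f = "\<lambda>k. M $$ (i,k) * upper_bidiagonal d a b $$ (k,j)"
  have e: "(M * upper_bidiagonal d a b) $$ (i,j) = (\<Sum>k<d+1. ?f k)"
    using assms by (intro mat_mult_entry[of _ "d+1" _ _ "d+1"]) auto
  show ?thesis
  proof (cases j)
    case 0
    have "(\<Sum>k<d+1. ?f k) = (\<Sum>k\<in>{0}. ?f k)"
      by (rule sum.mono_neutral_right) (use 0 in \<open>auto simp: upper_bidiagonal_entry\<close>)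
    then show ?thesis using 0 e by (simp add: upper_bidiagonal_entry)
  next
    case (Suc j')
    have "(\<Sum>k<d+1. ?f k) = ?f j' + (if j' + 1 \<le> d then ?f (j'+1) else 0)"
      using Suc j by (intro sum_two_neighbours) (auto simp: upper_bidiagonal_entry)
    then show ?thesis using Suc e j by (simp add: upper_bidiagonal_entry)
  qed
qed

lemma transpose_bidiagonal_mult_left:
  fixes M :: "'a::field mat"
  assumes M: "M \<in> carrier_mat (d+1) (d+1)" and i: "i \<le> d" and j: "j \<le> d"
  shows "((upper_bidiagonal d a b)\<^sup>T * M) $$ (i,j) =
    a i * M $$ (i,j) + (if 0 < i then b i * M $$ (i-1,j) else 0)"
proof -
  have "(upper_bidiagonal d a b)\<^sup>T * M = (M\<^sup>T * upper_bidiagonal d a b)\<^sup>T"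
    using M transpose_mult[of "M\<^sup>T" "d+1" "d+1" "upper_bidiagonal d a b" "d+1"] by simp
  then have "((upper_bidiagonal d a b)\<^sup>T * M) $$ (i,j) = (M\<^sup>T * upper_bidiagonal d a b) $$ (j,i)"
    using assms by simp
  also have "\<dots> = a i * M $$ (i,j) + (if 0 < i then b i * M $$ (i-1,j) else 0)"
    using assms by (subst upper_bidiagonal_mult_right) (auto simp: mult.commute)
  finally show ?thesis .
qed

lemma lower_bidiagonal_mult_left:
  fixes M :: "'a::field mat"
  assumes "M \<in> carrier_mat (d+1) (d+1)" "i \<le> d" "j \<le> d"
  shows "(lower_bidiagonal d a * M) $$ (i,j) =
    a i * M $$ (i,j) + (if 0 < i then M $$ (i-1,j) else 0)"
  unfolding lower_bidiagonal_eq_transpose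
  using assms by (subst transpose_bidiagonal_mult_left) auto

lemma lower_bidiagonal_mult_right:
  fixes M :: "'a::field mat"
  assumes M: "M \<in> carrier_mat (d+1) (d+1)" and i: "i \<le> d" and j: "j \<le> d"
  shows "(M * lower_bidiagonal d a) $$ (i,j) =
    M $$ (i,j) * a j + (if j + 1 \<le> d then M $$ (i,j+1) else 0)"
proof -
  have "M * lower_bidiagonal d a = (upper_bidiagonal d a (\<lambda>_. 1) * M\<^sup>T)\<^sup>T"
    unfolding lower_bidiagonal_eq_transpose
    using M transpose_mult[of "upper_bidiagonal d a (\<lambda>_. 1)" "d+1" "d+1" "M\<^sup>T" "d+1"] by simp
  then have "(M * lower_bidiagonal d a) $$ (i,j) = (upper_bidiagonal d a (\<lambda>_. 1) * M\<^sup>T) $$ (j,i)"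
    using assms by simp
  also have "\<dots> = M $$ (i,j) * a j + (if j + 1 \<le> d then M $$ (i,j+1) else 0)"
    using assms by (subst upper_bidiagonal_mult_left) (auto simp: mult.commute)
  finally show ?thesis .
qed

text \<open>
  Solving \<open>L v = a\<^sub>j v\<close> downwards from \<open>v\<^sub>j = 1\<close> gives the entries
  \<open>\<Prod>k\<in>{j<..i}. b\<^sub>k / (a\<^sub>j - a\<^sub>k)\<close>. The eigenvector matrix is unitriangular because the
  tails of the standard basis are \<open>L\<close>-invariant.
\<close>

lemma bidiagonal_eigenmatrix:
  fixes a b :: "nat \<Rightarrow> 'a::field"
  assumes distinct: "\<And>i j. i \<le> d \<Longrightarrow> j \<le> d \<Longrightarrow> i \<noteq> j \<Longrightarrow> a i \<noteq> a j"
  obtains Q Qi where "similar_mat_wit ((upper_bidiagonal d a b)\<^sup>T) (mat_diag (d+1) a) Q Qi"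
    "\<And>i j. i < j \<Longrightarrow> j \<le> d \<Longrightarrow> Q $$ (i,j) = 0" "\<And>i. i \<le> d \<Longrightarrow> Q $$ (i,i) = 1"
proof -
  let ?L = "(upper_bidiagonal d a b)\<^sup>T" and ?n = "d + 1"
  define Q where "Q = mat ?n ?n (\<lambda>(i,j). if j \<le> i then \<Prod>k\<in>{j<..i}. b k / (a j - a k) else 0)"
  have Q: "Q \<in> carrier_mat ?n ?n" by (simp add: Q_def)
  have low: "\<And>i j. i < j \<Longrightarrow> j < ?n \<Longrightarrow> Q $$ (i,j) = 0"
    and diag: "\<And>i. i < ?n \<Longrightarrow> Q $$ (i,i) = 1"
    by (auto simp: Q_def)
  have "det Q \<noteq> 0"
    using Q low diag by (intro det_lower_triangular_nonzero[of Q ?n]) auto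
  then obtain Qi where Qi: "Qi \<in> carrier_mat ?n ?n" "Q * Qi = 1\<^sub>m ?n" "Qi * Q = 1\<^sub>m ?n"
    using ex_inverse_of_det_nonzero[OF Q] by blast
  have LQ: "?L * Q = Q * mat_diag ?n a"
  proof (rule eq_matI)
    fix i j assume "i < dim_row (Q * mat_diag ?n a)" "j < dim_col (Q * mat_diag ?n a)"
    then have ij: "i \<le> d" "j \<le> d" using Q by (auto simp: mat_diag_def)
    have "a i * Q $$ (i,j) + (if 0 < i then b i * Q $$ (i-1,j) else 0) = Q $$ (i,j) * a j"
    proof (cases i j rule: linorder_cases)
      case less
      then show ?thesis using ij low[of i j] low[of "i-1" j] by auto
    next
      case equal
      then show ?thesis using ij low[of "i-1" j] by auto
    next
      case greater
      have "j \<le> i - 1" "{j<..i} = insert i {j<..i-1}" using greater by auto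
      then have "Q $$ (i,j) = b i / (a j - a i) * Q $$ (i-1,j)"
        using ij greater less_imp_le_nat by (auto simp: Q_def)
      moreover have "a j - a i \<noteq> 0" using distinct[of j i] ij greater by simp
      ultimately show ?thesis using greater by (auto simp: field_simps)
    qed
    then show "(?L * Q) $$ (i,j) = (Q * mat_diag ?n a) $$ (i,j)"
      using ij Q by (simp add: transpose_bidiagonal_mult_left mat_diag_mult_right_entry)
  qed (use Q in \<open>auto simp: mat_diag_def\<close>)
  have "?L = ?L * (Q * Qi)" using Qi by simp
  also have "\<dots> = ?L * Q * Qi"
    using Q Qi(1) by (simp flip: assoc_mult_mat[of _ ?n ?n _ ?n _ ?n])
  also have "\<dots> = Q * mat_diag ?n a * Qi"
    by (simp only: LQ)
  finally have "similar_mat_wit ?L (mat_diag ?n a) Q Qi"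
    using Q Qi by (intro similar_mat_witI[of _ _ ?n]) auto
  then show ?thesis using that low diag by auto
qed

text \<open>
  An upper bidiagonal matrix enlarges each tail \<open>span(e\<^sub>j, \<dots>, e\<^sub>d)\<close> by at most the one dimension
  \<open>e\<^sub>j\<^sub>-\<^sub>1\<close>, and really does so when \<open>b\<close> has no zero. A basis given by a lower triangular matrix
  has the same tails, so the matrix in that basis has the same shape above the diagonal.
\<close>

lemma bidiagonal_hessenberg:
  fixes Q S :: "'a::field mat"
  assumes Q: "Q \<in> carrier_mat (d+1) (d+1)" and S: "S \<in> carrier_mat (d+1) (d+1)"
    and low: "\<And>i j. i < j \<Longrightarrow> j \<le> d \<Longrightarrow> Q $$ (i,j) = 0"
    and diag: "\<And>i. i \<le> d \<Longrightarrow> Q $$ (i,i) \<noteq> 0"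
    and b: "\<And>i. 1 \<le> i \<Longrightarrow> i \<le> d \<Longrightarrow> b i \<noteq> 0"
    and US: "upper_bidiagonal d a b * Q = Q * S"
  shows "i + 1 < j \<Longrightarrow> j \<le> d \<Longrightarrow> S $$ (i,j) = 0"
    and "i + 1 \<le> d \<Longrightarrow> S $$ (i,i+1) \<noteq> 0"
proof -
  have QS: "(Q * S) $$ (i,j) = a i * Q $$ (i,j) + b (i+1) * Q $$ (i+1,j)"
    if "i + 1 \<le> d" "j \<le> d" for i j
    unfolding US[symmetric] using Q that by (simp add: upper_bidiagonal_mult_left)
  have zero: "(Q * S) $$ (i,j) = 0" if "i + 1 < j" "j \<le> d" for i j
    using that by (simp add: QS low)
  note solve = lower_triangular_solve[OF Q S low diag]
  show "S $$ (i,j) = 0" if "i + 1 < j" "j \<le> d" for i j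
    by (rule solve(1)[of j "j-1"]) (use that zero in auto)
  assume i: "i + 1 \<le> d"
  have "(Q * S) $$ (i,i+1) = Q $$ (i,i) * S $$ (i,i+1)"
    by (rule solve(2)) (use i zero in auto)
  moreover have "(Q * S) $$ (i,i+1) = b (i+1) * Q $$ (i+1,i+1)"
    using i by (simp add: QS low)
  ultimately show "S $$ (i,i+1) \<noteq> 0" using b[of "i+1"] diag[of "i+1"] i by auto
qed

section \<open>Change of eigenbasis\<close>

lemma similar_mat_diagD:
  assumes "similar_mat_wit A (mat_diag n a) Q Qi"
  shows "A \<in> carrier_mat n n" "Q \<in> carrier_mat n n" "Qi \<in> carrier_mat n n"
    "Q * Qi = 1\<^sub>m n" "Qi * Q = 1\<^sub>m n" "A = Q * mat_diag n a * Qi"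
    "A * Q = Q * mat_diag n a" "Qi * A = mat_diag n a * Qi"
proof -
  note w = similar_mat_witD[OF refl assms]
  have n: "dim_row A = n"
    using w(5) by (auto simp: mat_diag_def)
  note w = w[unfolded n]
  note as = assoc_mult_mat[of _ n n _ n _ n] mult_carrier_mat[of _ n n _ n]
  show "A \<in> carrier_mat n n" "Q \<in> carrier_mat n n" "Qi \<in> carrier_mat n n"
    "Q * Qi = 1\<^sub>m n" "Qi * Q = 1\<^sub>m n" "A = Q * mat_diag n a * Qi"
    by (fact w)+
  show "A * Q = Q * mat_diag n a"
    using w(1,2,6,7) by (simp add: as w(3) right_mult_one_mat[of _ n n])
  have "Qi * A = (Qi * Q) * mat_diag n a * Qi"
    using w(6,7) by (simp add: as w(3))
  then show "Qi * A = mat_diag n a * Qi"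
    using w by simp
qed

lemma mult_inverse_cancel:
  fixes X :: "'a::semiring_1 mat"
  assumes "X * Y = 1\<^sub>m n" "X \<in> carrier_mat n n" "Y \<in> carrier_mat n n" "M \<in> carrier_mat n m"
  shows "X * (Y * M) = M"
proof -
  have "X * (Y * M) = X * Y * M"
    using assms(2-4) by (rule assoc_mult_mat[symmetric])
  then show ?thesis using left_mult_one_mat[OF assms(4)] by (simp only: assms(1))
qed

text \<open>
  The eigenvector equations with a further factor \<open>M\<close>, the form in which they apply inside products
  associated to the right.
\<close>

lemma similar_mat_diag_push:
  assumes "similar_mat_wit A (mat_diag n a) Q Qi" "M \<in> carrier_mat n m"
  shows "Qi * (Q * M) = M" "Q * (Qi * M) = M"
    "A * (Q * M) = Q * (mat_diag n a * M)" "Qi * (A * M) = mat_diag n a * (Qi * M)"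
proof -
  note w = similar_mat_diagD[OF assms(1)]
  show "Qi * (Q * M) = M" "Q * (Qi * M) = M"
    using w assms(2) by (auto intro: mult_inverse_cancel)
  have "A * (Q * M) = (A * Q) * M" "Qi * (A * M) = (Qi * A) * M"
    using w(1-3) assms(2) by (auto intro: assoc_mult_mat[symmetric])
  then show "A * (Q * M) = Q * (mat_diag n a * M)" "Qi * (A * M) = mat_diag n a * (Qi * M)"
    unfolding w(7,8) using w(2,3) assms(2) by (simp_all add: assoc_mult_mat[of _ n n _ n _ m])
qed

lemma eigenvalue_similar_mat_diag:
  fixes A :: "'a::field mat"
  assumes "similar_mat_wit A (mat_diag n a) Q Qi"
  shows "{t. eigenvalue A t} = a ` {..<n}"
proof -
  note A = similar_mat_diagD(1)[OF assms]
  have "char_poly A = char_poly (mat_diag n a)"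
    using assms by (intro char_poly_similar) (auto simp: similar_mat_def)
  also have "\<dots> = (\<Prod>c\<leftarrow>diag_mat (mat_diag n a). [:- c, 1:])"
    by (rule char_poly_upper_triangular[of _ n]) (auto simp: mat_diag_def)
  finally have "char_poly A = (\<Prod>c\<leftarrow>diag_mat (mat_diag n a). [:- c, 1:])" .
  moreover have "set (diag_mat (mat_diag n a)) = a ` {..<n}"
    by (auto simp: diag_mat_def mat_diag_def)
  ultimately show ?thesis
    by (auto simp: eigenvalue_root_char_poly[OF A] poly_prod_list prod_list_zero_iff o_def)
qed

lemma nonzero_entry_in_column:
  fixes C :: "'a::field mat"
  assumes "C \<in> carrier_mat n n" "Ci \<in> carrier_mat n n" "Ci * C = 1\<^sub>m n" "j < n"
  shows "\<exists>i<n. C $$ (i,j) \<noteq> 0"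
proof (rule ccontr)
  assume "\<not> ?thesis"
  then have "(Ci * C) $$ (j,j) = 0"
    unfolding mat_mult_entry[OF assms(2,1,4,4)] by simp
  then show False using assms by simp
qed

text \<open>
  An eigenbasis of a matrix with simple spectrum is unique up to order and scaling, so the
  transition matrix is monomial; conjugating by a monomial matrix only permutes a zero pattern.
\<close>

lemma eigenbasis_change:
  fixes B :: "'a::field mat"
  assumes R: "similar_mat_wit B (mat_diag n a) R Ri" and R': "similar_mat_wit B (mat_diag n b) R' Ri'"
    and distinct: "\<And>i j. i < n \<Longrightarrow> j < n \<Longrightarrow> i \<noteq> j \<Longrightarrow> a i \<noteq> a j"
  obtains \<sigma> where "bij_betw \<sigma> {..<n} {..<n}" "\<And>j. j < n \<Longrightarrow> b j = a (\<sigma> j)"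
    "\<And>A i j. A \<in> carrier_mat n n \<Longrightarrow> i < n \<Longrightarrow> j < n \<Longrightarrow>
       (Ri' * A * R') $$ (i,j) = 0 \<longleftrightarrow> (Ri * A * R) $$ (\<sigma> i, \<sigma> j) = 0"
proof -
  note r = similar_mat_diagD[OF R] and r' = similar_mat_diagD[OF R']
  note as = assoc_mult_mat[of _ n n _ n _ n] mult_carrier_mat[of _ n n _ n]
  define C where "C = Ri * R'"
  define Ci where "Ci = Ri' * R"
  have C: "C \<in> carrier_mat n n" and Ci: "Ci \<in> carrier_mat n n"
    using r r' by (auto simp: C_def Ci_def)
  note canc = similar_mat_diag_push(1,2)[OF R, where m = n] similar_mat_diag_push(1,2)[OF R', where m = n]
  have CCi: "C * Ci = 1\<^sub>m n" "Ci * C = 1\<^sub>m n"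
    using r(2-5) r'(2-5) by (simp_all add: C_def Ci_def as canc)
  have "mat_diag n a * C = Ri * (B * R')"
    unfolding C_def using r'(2) by (rule similar_mat_diag_push(4)[OF R, symmetric])
  also have "\<dots> = C * mat_diag n b"
    unfolding r'(7) C_def using r(3) r'(2) by (simp add: as)
  finally have comm: "mat_diag n a * C = C * mat_diag n b" .
  \<comment> \<open>Columns of C relate eigenvectors: a nonzero entry forces equal eigenvalues.\<close>
  have entry: "a i = b j" if "i < n" "j < n" "C $$ (i,j) \<noteq> 0" for i j
    using arg_cong[OF comm, of "\<lambda>M. M $$ (i,j)"] that C
    by (simp add: mat_diag_mult_left_entry mat_diag_mult_right_entry)
  define \<sigma> where "\<sigma> = (\<lambda>j. SOME i. i < n \<and> C $$ (i,j) \<noteq> 0)"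
  have \<sigma>: "\<sigma> j < n" "C $$ (\<sigma> j, j) \<noteq> 0" if "j < n" for j
    using someI_ex[of "\<lambda>i. i < n \<and> C $$ (i,j) \<noteq> 0"] nonzero_entry_in_column[OF C Ci CCi(2) that]
    unfolding \<sigma>_def by auto
  have b: "b j = a (\<sigma> j)" if "j < n" for j
    using entry[of "\<sigma> j" j] \<sigma>[OF that] that by simp
  have uniq: "C $$ (i,j) = 0" if "i < n" "j < n" "i \<noteq> \<sigma> j" for i j
    using entry[of i j] b[of j] distinct[of i "\<sigma> j"] \<sigma>[of j] that by auto
  have "\<sigma> ` {..<n} = {..<n}"
  proof (intro subset_antisym subsetI)
    fix i assume "i \<in> {..<n}"
    then have i: "i < n" by simp
    have "\<exists>j<n. C $$ (i,j) \<noteq> 0"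
      using nonzero_entry_in_column[of "C\<^sup>T" n "Ci\<^sup>T" i] C Ci CCi i transpose_mult[OF C Ci] by auto
    then obtain j where "j < n" "C $$ (i,j) \<noteq> 0" by blast
    with uniq i show "i \<in> \<sigma> ` {..<n}" by blast
  qed (use \<sigma> in auto)
  then have bij: "bij_betw \<sigma> {..<n} {..<n}"
    by (simp add: bij_betw_def eq_card_imp_inj_on)
  have "(Ri' * A * R') $$ (i,j) = 0 \<longleftrightarrow> (Ri * A * R) $$ (\<sigma> i, \<sigma> j) = 0"
    if A: "A \<in> carrier_mat n n" and i: "i < n" and j: "j < n" for A i j
  proof -
    define T where "T = Ri * A * R"
    define T' where "T' = Ri' * A * R'"
    have T: "T \<in> carrier_mat n n" "T' \<in> carrier_mat n n"
      using A r r' by (auto simp: T_def T'_def)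
    have "T * C = C * T'"
      using A r(2-3) r'(2-3) by (simp add: T_def T'_def C_def as canc)
    moreover have "(T * C) $$ (\<sigma> i, j) = T $$ (\<sigma> i, \<sigma> j) * C $$ (\<sigma> j, j)"
    proof -
      have "(T * C) $$ (\<sigma> i, j) = (\<Sum>k\<in>{\<sigma> j}. T $$ (\<sigma> i, k) * C $$ (k, j))"
        unfolding mat_mult_entry[OF T(1) C \<sigma>(1)[OF i] j]
        by (rule sum.mono_neutral_right) (use uniq j \<sigma> in auto)
      then show ?thesis by simp
    qed
    moreover have "(C * T') $$ (\<sigma> i, j) = C $$ (\<sigma> i, i) * T' $$ (i, j)"
    proof -
      have "C $$ (\<sigma> i, k) = 0" if "k < n" "k \<noteq> i" for k
        using that uniq[of "\<sigma> i" k] \<sigma>[OF i] bij i by (auto simp: bij_betw_def inj_on_def)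
      then have "(C * T') $$ (\<sigma> i, j) = (\<Sum>k\<in>{i}. C $$ (\<sigma> i, k) * T' $$ (k, j))"
        unfolding mat_mult_entry[OF C T(2) \<sigma>(1)[OF i] j]
        by (intro sum.mono_neutral_right) (use i in auto)
      then show ?thesis by simp
    qed
    ultimately show ?thesis
      using \<sigma>[OF i] \<sigma>[OF j] unfolding T_def T'_def by auto
  qed
  with that bij b show ?thesis by blast
qed

lemma commutes_with_distinct_diag:
  fixes N :: "'a::field mat"
  assumes "N \<in> carrier_mat n n" "N * mat_diag n a = mat_diag n a * N"
    and "\<And>i j. i < n \<Longrightarrow> j < n \<Longrightarrow> i \<noteq> j \<Longrightarrow> a i \<noteq> a j"
  shows "N = mat_diag n (\<lambda>i. N $$ (i,i))"
proof (rule eq_matI)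
  fix i j assume "i < dim_row (mat_diag n (\<lambda>i. N $$ (i,i)))" "j < dim_col (mat_diag n (\<lambda>i. N $$ (i,i)))"
  then have ij: "i < n" "j < n" by (auto simp: mat_diag_def)
  have "N $$ (i,j) * a j = a i * N $$ (i,j)"
    using arg_cong[OF assms(2), of "\<lambda>M. M $$ (i,j)"] ij assms(1)
    by (simp add: mat_diag_mult_left_entry mat_diag_mult_right_entry)
  then show "N $$ (i,j) = mat_diag n (\<lambda>i. N $$ (i,i)) $$ (i,j)"
    using ij assms(3)[of i j] by (auto simp: algebra_simps)
qed (use assms(1) in \<open>auto simp: mat_diag_def\<close>)

text \<open>
  Both sides are tridiagonal with the same diagonal, so the equation amounts to the recursion
  \<open>k\<^sub>i\<^sub>+\<^sub>1 = k\<^sub>i T\<^sub>i\<^sub>,\<^sub>i\<^sub>+\<^sub>1 / T\<^sub>i\<^sub>+\<^sub>1\<^sub>,\<^sub>i\<close>, solvable because neither neighbour of the diagonal vanishes.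
\<close>

lemma tridiagonal_symmetrizer:
  fixes T :: "'a::field mat"
  assumes T: "irreducible_tridiagonal n T"
  obtains k where "\<And>i. k i \<noteq> 0" "mat_diag n k * T = T\<^sup>T * mat_diag n k"
proof -
  define k where "k i = (\<Prod>m<i. if m + 1 < n then T $$ (m,m+1) / T $$ (m+1,m) else 1)" for i
  have nz: "T $$ (i,j) \<noteq> 0" if "i < n" "j < n" "\<bar>int i - int j\<bar> = 1" for i j
    using T that unfolding irreducible_tridiagonal_def by simp
  have z: "T $$ (i,j) = 0" if "i < n" "j < n" "\<bar>int i - int j\<bar> > 1" for i j
    using T that unfolding irreducible_tridiagonal_def by simp
  have c: "T \<in> carrier_mat n n" using T by (simp add: irreducible_tridiagonal_def)
  have k: "k i \<noteq> 0" for i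
    by (auto simp: k_def nz)
  have step: "k i * T $$ (i,i+1) = T $$ (i+1,i) * k (i+1)" if "i + 1 < n" for i
    using that nz[of "i+1" i] by (simp add: k_def)
  have "k i * T $$ (i,j) = T $$ (j,i) * k j" if ij: "i < n" "j < n" for i j
  proof -
    consider "i = j" | "j = i + 1" | "i = j + 1" | "\<bar>int i - int j\<bar> > 1" by linarith
    then show ?thesis
    proof cases
      case 2 then show ?thesis using step[of i] ij by simp
    next
      case 3 then show ?thesis using step[of j] ij by (simp add: mult.commute)
    next
      case 4
      then have "\<bar>int j - int i\<bar> > 1" by linarith
      with 4 show ?thesis using z ij by simp
    qed (simp add: mult.commute)
  qed
  then have "mat_diag n k * T = T\<^sup>T * mat_diag n k"
    using c by (intro eq_matI) (auto simp: mat_diag_mult_left mat_diag_mult_right)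
  with k that show ?thesis by blast
qed

text \<open>
  This is the antiautomorphism fixing both matrices. The diagonal symmetrizer \<open>K\<close> in the eigenbasis
  of \<open>B\<close> is a symmetric bilinear form for which \<open>A\<close> and \<open>B\<close> are both self-adjoint. Eigenvectors of
  \<open>A\<close> for different eigenvalues are therefore orthogonal, so the Gram matrix \<open>N\<close> of an eigenbasis
  of \<open>A\<close> is an invertible diagonal matrix, and self-adjointness of \<open>B\<close> reads \<open>N H = H\<^sup>T N\<close>.
\<close>

lemma eigenbasis_pattern_symmetric:
  fixes A B :: "'a::field mat"
  assumes Q: "similar_mat_wit A (mat_diag n a) Q Qi" and P: "similar_mat_wit B (mat_diag n b) P Pv"
    and distinct: "\<And>i j. i < n \<Longrightarrow> j < n \<Longrightarrow> i \<noteq> j \<Longrightarrow> a i \<noteq> a j"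
    and T: "irreducible_tridiagonal n (Pv * A * P)"
    and i: "i < n" and j: "j < n"
  shows "(Qi * B * Q) $$ (i,j) = 0 \<longleftrightarrow> (Qi * B * Q) $$ (j,i) = 0"
proof -
  note q = similar_mat_diagD[OF Q] and p = similar_mat_diagD[OF P]
  note as = assoc_mult_mat[of _ n n _ n _ n] mult_carrier_mat[of _ n n _ n]
  obtain k where k: "\<And>i. k i \<noteq> 0" "mat_diag n k * (Pv * A * P) = (Pv * A * P)\<^sup>T * mat_diag n k"
    using tridiagonal_symmetrizer[OF T] by metis
  note canc = similar_mat_diag_push(1,2)[OF Q, where m = n] similar_mat_diag_push(1,2)[OF P, where m = n]
  define C where "C = Pv * Q"
  define Ci where "Ci = Qi * P"
  define T' where "T' = Pv * A * P"
  define H where "H = Qi * B * Q"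
  define K where "K = mat_diag n k"
  define N where "N = C\<^sup>T * K * C"
  have carr: "C \<in> carrier_mat n n" "Ci \<in> carrier_mat n n" "T' \<in> carrier_mat n n"
    "H \<in> carrier_mat n n" "K \<in> carrier_mat n n" "N \<in> carrier_mat n n"
    using q p by (auto simp: C_def Ci_def T'_def H_def K_def N_def)
  have CCi: "C * Ci = 1\<^sub>m n" "Ci * C = 1\<^sub>m n"
    using q(2-5) p(2-5) by (simp_all add: C_def Ci_def as canc)
  have KT: "K * T' = T'\<^sup>T * K" using k by (simp add: K_def T'_def)
  have TC: "T' * C = C * mat_diag n a"
    using q(1-3) p(2-3) by (simp add: T'_def C_def as canc q(7))
  have DC: "mat_diag n b * C = C * H"
  proof -
    have "mat_diag n b * C = Pv * (B * Q)"
      unfolding C_def using q(2) by (rule similar_mat_diag_push(4)[OF P, symmetric])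
    then show ?thesis using p(1-3) q(2-3) by (simp add: C_def H_def as canc)
  qed
  have tr: "(M * L)\<^sup>T = L\<^sup>T * M\<^sup>T" if "M \<in> carrier_mat n n" "L \<in> carrier_mat n n" for M L :: "'a mat"
    using that by (rule transpose_mult)
  have "N * mat_diag n a = C\<^sup>T * (K * T') * C"
    using carr by (simp add: N_def as TC)
  also have "\<dots> = (T' * C)\<^sup>T * (K * C)"
    unfolding KT using carr by (simp add: tr as)
  also have "\<dots> = mat_diag n a * N"
    unfolding TC using carr by (simp add: tr as N_def)
  finally have "N = mat_diag n (\<lambda>i. N $$ (i,i))"
    using carr distinct by (intro commutes_with_distinct_diag)
  then obtain f where f: "N = mat_diag n f" by blast
  have "N * H = C\<^sup>T * (K * mat_diag n b) * C"
    using carr by (simp add: N_def as DC)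
  also have "\<dots> = C\<^sup>T * (mat_diag n b * K) * C"
    by (simp add: K_def mult.commute)
  also have "\<dots> = (mat_diag n b * C)\<^sup>T * (K * C)"
    using carr by (simp add: tr as)
  also have "\<dots> = H\<^sup>T * N"
    unfolding DC using carr by (simp add: tr as N_def)
  finally have "(N * H) $$ (i,j) = (H\<^sup>T * N) $$ (i,j)" by simp
  then have sym: "f i * H $$ (i,j) = H $$ (j,i) * f j"
    using carr i j by (simp add: f mat_diag_mult_left mat_diag_mult_right)
  have "f l \<noteq> 0" if l: "l < n" for l
  proof
    assume "f l = 0"
    have "det K \<noteq> 0"
      unfolding K_def by (rule det_lower_triangular_nonzero[of _ n]) (auto simp: k)
    moreover have "det C \<noteq> 0" using det_mult[OF carr(1,2)] CCi by auto
    ultimately have "det N \<noteq> 0"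
      using carr by (simp add: N_def det_mult[of _ n] det_transpose[of _ n])
    moreover have "det N = 0"
      unfolding f using l \<open>f l = 0\<close>
      by (subst det_lower_triangular[of n]) (auto simp: prod_list_zero_iff diag_mat_def mat_diag_def)
    ultimately show False by simp
  qed
  with i j sym show ?thesis unfolding H_def by (metis mult_eq_0_iff)
qed

section \<open>Bases and Leonard pairs\<close>

lemma ordered_basis_carrier:
  fixes vs :: "'a::field vec list"
  assumes "ordered_basis n vs"
  shows "set vs \<subseteq> carrier_vec n"
proof -
  interpret vec_space "TYPE('a)" n .
  show ?thesis using assms by (auto simp: ordered_basis_def basis_def)
qed

lemma ordered_basis_iff_det:
  fixes vs :: "'a::field vec list"
  assumes M: "M \<in> carrier_mat n n" and vs: "cols M = vs"
  shows "ordered_basis n vs \<longleftrightarrow> det M \<noteq> 0"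
proof -
  interpret vec_space "TYPE('a)" n .
  have len: "length vs = n" and dim: "set vs \<subseteq> carrier_vec n"
    using M vs cols_dim[of M] by auto
  show ?thesis
  proof
    assume "ordered_basis n vs"
    then have "rank M = n"
      using M vs unfolding ordered_basis_def basis_def by (intro lin_indpt_full_rank) auto
    then show "det M \<noteq> 0" by (simp add: det_rank_iff[OF M])
  next
    assume det: "det M \<noteq> 0"
    then have "rank M = n" by (simp add: det_rank_iff[OF M])
    then have dist: "distinct vs"
      using non_distinct_low_rank[OF M] vs by auto
    have "lin_indpt (set vs)"
      using full_rank_lin_indpt[OF M \<open>rank M = n\<close>] dist vs by simp
    then have "basis (set vs)"
      using dist len dim by (intro dim_li_is_basis) (auto simp: distinct_card dim_is_n)
    with dist len show "ordered_basis n vs" by (simp add: ordered_basis_def)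
  qed
qed

lemma leonard_pairI:
  fixes A B :: "'a::field mat"
  assumes Q: "similar_mat_wit A (mat_diag (d+1) a) Q Qi" and P: "similar_mat_wit B (mat_diag (d+1) b) P Pv"
    and T: "irreducible_tridiagonal (d+1) (Pv * A * P)" and H: "irreducible_tridiagonal (d+1) (Qi * B * Q)"
  shows "leonard_pair d A B"
proof -
  let ?n = "d + 1"
  note q = similar_mat_diagD[OF Q] and p = similar_mat_diagD[OF P]
  have inv: "det X \<noteq> 0" if "X \<in> carrier_mat ?n ?n" "Y \<in> carrier_mat ?n ?n" "X * Y = 1\<^sub>m ?n" for X Y :: "'a mat"
    using det_mult[OF that(1,2)] that(3) by auto
  have rep: "ordered_basis ?n (cols X) \<and> represents ?n (cols X) M (Y * M * X)"
    if "X \<in> carrier_mat ?n ?n" "Y \<in> carrier_mat ?n ?n" "X * Y = 1\<^sub>m ?n" "M \<in> carrier_mat ?n ?n"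
    for X Y M :: "'a mat"
  proof -
    have "mat_of_cols ?n (cols X) = X" using mat_of_cols_cols[of X] that(1) by (simp only: carrier_matD)
    moreover have "M * X = X * (Y * M * X)"
      using mult_inverse_cancel[OF that(3,1,2), of "M * X" ?n] that by (simp add: assoc_mult_mat[of _ ?n ?n _ ?n _ ?n])
    ultimately show ?thesis
      using that inv[OF that(1-3)] ordered_basis_iff_det[OF that(1) refl] by (simp add: represents_def)
  qed
  have "Pv * B * P = mat_diag ?n b" "Qi * A * Q = mat_diag ?n a"
    using p(2,3,5) q(2,3,5) by (simp_all add: p(8) q(8) assoc_mult_mat[of _ ?n ?n _ ?n _ ?n]
      right_mult_one_mat[of _ "Suc d" "Suc d"])
  then have "diagonal_mat (Pv * B * P)" "diagonal_mat (Qi * A * Q)"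
    by (auto simp: diagonal_mat_def mat_diag_def)
  then show ?thesis
    unfolding leonard_pair_def
    using rep[OF p(2,3,4) q(1)] rep[OF p(2,3,4) p(1)] rep[OF q(2,3,4) p(1)] rep[OF q(2,3,4) q(1)] T H q(1) p(1)
    by blast
qed

lemma leonard_pair_eigenbasis:
  fixes A B :: "'a::field mat"
  assumes "leonard_pair d A B"
  obtains b R Ri where "similar_mat_wit B (mat_diag (d+1) b) R Ri"
    "irreducible_tridiagonal (d+1) (Ri * A * R)"
proof -
  let ?n = "d + 1"
  obtain vs T D where A: "A \<in> carrier_mat ?n ?n" and B: "B \<in> carrier_mat ?n ?n"
    and vs: "ordered_basis ?n vs" and T: "represents ?n vs A T" "irreducible_tridiagonal ?n T"
    and D: "represents ?n vs B D" "diagonal_mat D"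
    using assms unfolding leonard_pair_def by metis
  define R where "R = mat_of_cols ?n vs"
  have len: "length vs = ?n" using vs by (simp add: ordered_basis_def)
  then have R: "R \<in> carrier_mat ?n ?n" by (auto simp: R_def)
  have "set vs \<subseteq> carrier_vec ?n" using vs by (rule ordered_basis_carrier)
  then have "cols R = vs" by (simp add: R_def)
  then have "det R \<noteq> 0" using vs ordered_basis_iff_det[OF R] by simp
  then obtain Ri where Ri: "Ri \<in> carrier_mat ?n ?n" "R * Ri = 1\<^sub>m ?n" "Ri * R = 1\<^sub>m ?n"
    using ex_inverse_of_det_nonzero[OF R] by blast
  have Tc: "T \<in> carrier_mat ?n ?n" and Dc: "D \<in> carrier_mat ?n ?n"
    and AR: "A * R = R * T" and BR: "B * R = R * D"
    using T D by (auto simp: represents_def R_def)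
  have "D = mat_diag ?n (\<lambda>i. D $$ (i,i))"
    using D(2) Dc by (intro eq_matI) (auto simp: diagonal_mat_def mat_diag_def)
  moreover have "B = R * D * Ri"
  proof -
    have "B = B * (R * Ri)" using Ri B by simp
    also have "\<dots> = B * R * Ri" using B R Ri(1) by simp
    finally show ?thesis by (simp only: BR)
  qed
  ultimately have "similar_mat_wit B (mat_diag ?n (\<lambda>i. D $$ (i,i))) R Ri"
    using R Ri B Dc by (intro similar_mat_witI[of _ _ ?n]) auto
  moreover have "Ri * A * R = T"
    using mult_inverse_cancel[OF Ri(3,1) R Tc] R Ri(1) A by (simp add: AR)
  ultimately show ?thesis using that T(2) by metis
qed

section \<open>Functions of a diagonalized matrix\<close>

lemma diag_conj_entry:
  fixes Q :: "'a::field mat"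
  assumes "Q \<in> carrier_mat n n" "Qi \<in> carrier_mat n n" "i < n" "j < n"
  shows "(Q * mat_diag n f * Qi) $$ (i,j) = (\<Sum>k<n. Q $$ (i,k) * f k * Qi $$ (k,j))"
  using assms by (subst mat_mult_entry[of _ n n _ n]) (auto simp: mat_diag_mult_right)

lemma diag_conj_mult:
  fixes Q :: "'a::field mat"
  assumes "Q \<in> carrier_mat n n" "Qi \<in> carrier_mat n n" "Qi * Q = 1\<^sub>m n"
  shows "(Q * mat_diag n f * Qi) * (Q * mat_diag n g * Qi) = Q * mat_diag n (\<lambda>k. f k * g k) * Qi"
proof -
  have "mat_diag n f * (Qi * (Q * (mat_diag n g * Qi))) = mat_diag n (\<lambda>k. f k * g k) * Qi"
    using mult_inverse_cancel[OF assms(3,2,1), of "mat_diag n g * Qi" n] assms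
      assoc_mult_mat[of "mat_diag n f" n n "mat_diag n g" n Qi n]
    by (simp add: mult_carrier_mat[of _ n n])
  then show ?thesis
    using assms(1,2) by (simp add: assoc_mult_mat[of _ n n _ n _ n] mult_carrier_mat[of _ n n _ n])
qed

lemma diag_conj_eqD:
  fixes Q :: "'a::field mat"
  assumes Q: "Q \<in> carrier_mat n n" "Qi \<in> carrier_mat n n" "Qi * Q = 1\<^sub>m n"
    and eq: "Q * mat_diag n f * Qi = Q * mat_diag n g * Qi" and k: "k < n"
  shows "f k = g k"
proof -
  have "Qi * (Q * mat_diag n h * Qi) * Q = mat_diag n h" for h
    using mult_inverse_cancel[OF Q(3,2,1), where m = n] Q
    by (simp add: assoc_mult_mat[of _ n n _ n _ n] mult_carrier_mat[of _ n n _ n] right_mult_one_mat[of _ n n])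
  then have "mat_diag n f = mat_diag n g" using eq by metis
  then have "mat_diag n f $$ (k,k) = mat_diag n g $$ (k,k)" by simp
  then show ?thesis using k by simp
qed

lemma mat_prod_list_shifts:
  fixes A :: "'a::field mat"
  assumes Q: "similar_mat_wit A (mat_diag n a) Q Qi"
  shows "mat_prod_list n (map (\<lambda>j. c j \<cdot>\<^sub>m (A - t j \<cdot>\<^sub>m 1\<^sub>m n)) js) =
    Q * mat_diag n (\<lambda>k. \<Prod>j\<leftarrow>js. c j * (a k - t j)) * Qi"
proof (induction js)
  case Nil
  show ?case using similar_mat_diagD(2-4)[OF Q] by (simp add: mat_prod_list_def right_mult_one_mat[of _ n n])
next
  case (Cons j js)
  note q = similar_mat_diagD[OF Q]
  have "c j \<cdot>\<^sub>m (A - t j \<cdot>\<^sub>m 1\<^sub>m n) = Q * mat_diag n (\<lambda>k. c j * (a k - t j)) * Qi"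
  proof (rule eq_matI)
    fix i l assume "i < dim_row (Q * mat_diag n (\<lambda>k. c j * (a k - t j)) * Qi)"
      "l < dim_col (Q * mat_diag n (\<lambda>k. c j * (a k - t j)) * Qi)"
    then have il: "i < n" "l < n" using q by auto
    have "A $$ (i,l) = (\<Sum>k<n. Q $$ (i,k) * a k * Qi $$ (k,l))"
      using q(6) diag_conj_entry[OF q(2,3) il] by simp
    moreover have "1\<^sub>m n $$ (i,l) = (\<Sum>k<n. Q $$ (i,k) * Qi $$ (k,l))"
      using mat_mult_entry[OF q(2,3) il] q(4) by simp
    ultimately have "c j * (A $$ (i,l) - t j * 1\<^sub>m n $$ (i,l)) =
        (\<Sum>k<n. Q $$ (i,k) * (c j * (a k - t j)) * Qi $$ (k,l))"
      by (simp add: algebra_simps sum_distrib_left flip: sum_subtractf)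
    then show "(c j \<cdot>\<^sub>m (A - t j \<cdot>\<^sub>m 1\<^sub>m n)) $$ (i,l) = (Q * mat_diag n (\<lambda>k. c j * (a k - t j)) * Qi) $$ (i,l)"
      unfolding diag_conj_entry[OF q(2,3) il] using il q(1) by simp
  qed (use q in auto)
  with Cons show ?case
    by (simp add: mat_prod_list_def diag_conj_mult[OF q(2,3,5)])
qed

text \<open>
  Only the sets of values of \<open>a\<close> and \<open>\<theta>\<close> are compared, not their order. This generality identifies
  an idempotent that is given through some other ordering of the eigenvalues.
\<close>

lemma primitive_idempotent_diag:
  fixes A :: "'a::field mat"
  assumes Q: "similar_mat_wit A (mat_diag (d+1) a) Q Qi"
    and inj: "inj_on \<theta> {..d}" and range: "a ` {..d} \<subseteq> \<theta> ` {..d}" and i: "i \<le> d"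
  shows "primitive_idempotent d A \<theta> i = Q * mat_diag (d+1) (\<lambda>k. if a k = \<theta> i then 1 else 0) * Qi"
proof -
  have "(\<Prod>j\<leftarrow>filter (\<lambda>j. j \<noteq> i) [0..<d+1]. 1 / (\<theta> i - \<theta> j) * (a k - \<theta> j)) = (if a k = \<theta> i then 1 else 0)"
    (is "prod_list (map ?f ?js) = _") if k: "k \<le> d" for k
  proof (cases "a k = \<theta> i")
    case True
    have "map ?f ?js = map (\<lambda>_. 1) ?js"
      using True inj i by (auto simp: inj_on_def)
    then show ?thesis using True by (simp add: map_replicate_const)
  next
    case False
    obtain j where j: "j < d + 1" "a k = \<theta> j"
      using subsetD[OF range, of "a k"] k by (auto simp: less_Suc_eq_le)
    have "j \<noteq> i" using False j(2) by auto
    then have "0 \<in> ?f ` set ?js" using j by (intro image_eqI[of _ _ j]) auto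
    then have "0 \<in> set (map ?f ?js)" by (simp only: set_map)
    then show ?thesis using False by (simp only: prod_list_zero_iff if_False)
  qed
  then have "mat_diag (d+1) (\<lambda>k. \<Prod>j\<leftarrow>filter (\<lambda>j. j \<noteq> i) [0..<d+1]. 1 / (\<theta> i - \<theta> j) * (a k - \<theta> j)) =
      mat_diag (d+1) (\<lambda>k. if a k = \<theta> i then 1 else 0)"
    by (intro eq_matI) (auto simp: mat_diag_def)
  then show ?thesis
    unfolding primitive_idempotent_def mat_prod_list_shifts[OF Q] by simp
qed

lemma eigenvalue_ordering_diag:
  fixes A :: "'a::field mat"
  assumes Q: "similar_mat_wit A (mat_diag (d+1) a) Q Qi" and inj: "inj_on a {..d}"
  shows "eigenvalue_ordering d A a" "multiplicity_free d A"
  using inj similar_mat_diagD(1)[OF Q] eigenvalue_similar_mat_diag[OF Q]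
  by (auto simp: eigenvalue_ordering_def multiplicity_free_def bij_betw_def lessThan_Suc_atMost card_image)

lemma idempotent_eigenvalue_diag:
  fixes A :: "'a::field mat"
  assumes Q: "similar_mat_wit A (mat_diag (d+1) a) Q Qi" and inj: "inj_on a {..d}" and i: "i \<le> d"
  shows "idempotent_eigenvalue d A (primitive_idempotent d A a i) = a i"
  unfolding idempotent_eigenvalue_def
proof (rule the_equality)
  show "\<exists>\<theta> j. eigenvalue_ordering d A \<theta> \<and> j \<le> d \<and> a i = \<theta> j \<and>
      primitive_idempotent d A a i = primitive_idempotent d A \<theta> j"
    using eigenvalue_ordering_diag(1)[OF Q inj] i by blast
next
  note q = similar_mat_diagD[OF Q]
  fix t
  assume "\<exists>\<theta> j. eigenvalue_ordering d A \<theta> \<and> j \<le> d \<and> t = \<theta> j \<and>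
      primitive_idempotent d A a i = primitive_idempotent d A \<theta> j"
  then obtain \<theta> j where \<theta>: "bij_betw \<theta> {..d} {t. eigenvalue A t}" and j: "j \<le> d" and t: "t = \<theta> j"
    and eq: "primitive_idempotent d A a i = primitive_idempotent d A \<theta> j"
    by (auto simp: eigenvalue_ordering_def)
  have "a ` {..d} \<subseteq> \<theta> ` {..d}" "inj_on \<theta> {..d}"
    using \<theta> eigenvalue_similar_mat_diag[OF Q] by (auto simp: bij_betw_def lessThan_Suc_atMost)
  then have "(if a i = a i then 1 else 0 :: 'a) = (if a i = \<theta> j then 1 else 0)"
    using eq i j inj diag_conj_eqD[OF q(2,3,5), of "\<lambda>k. if a k = a i then 1 else 0" "\<lambda>k. if a k = \<theta> j then 1 else 0" i]
    by (simp add: primitive_idempotent_diag[OF Q])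
  then show "t = a i" using t by (simp split: if_splits)
qed

lemma pow_mat_diag_conj:
  fixes A :: "'a::field mat"
  assumes Q: "similar_mat_wit A (mat_diag n a) Q Qi"
  shows "A ^\<^sub>m m = Q * mat_diag n (\<lambda>k. a k ^ m) * Qi"
proof (induction m)
  case 0
  show ?case using similar_mat_diagD(1-4)[OF Q] by (simp add: right_mult_one_mat[of _ n n])
next
  case (Suc m)
  note q = similar_mat_diagD[OF Q]
  have "A ^\<^sub>m Suc m = (Q * mat_diag n (\<lambda>k. a k ^ m) * Qi) * (Q * mat_diag n a * Qi)"
    using Suc q(6) by simp
  then show ?case by (simp add: diag_conj_mult[OF q(2,3,5)] mult.commute)
qed

lemma poly_at_mat_diag_conj:
  fixes A :: "'a::field mat"
  assumes Q: "similar_mat_wit A (mat_diag n a) Q Qi"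
  shows "poly_at_mat p A = Q * mat_diag n (\<lambda>k. poly p (a k)) * Qi"
proof (rule eq_matI)
  note q = similar_mat_diagD[OF Q]
  fix i j assume "i < dim_row (Q * mat_diag n (\<lambda>k. poly p (a k)) * Qi)"
    "j < dim_col (Q * mat_diag n (\<lambda>k. poly p (a k)) * Qi)"
  then have ij: "i < n" "j < n" using q by auto
  have "poly_at_mat p A $$ (i,j) = (\<Sum>m\<le>degree p. coeff p m * (\<Sum>k<n. Q $$ (i,k) * a k ^ m * Qi $$ (k,j)))"
    using ij q(1) by (simp add: poly_at_mat_def mat_lincomb_def pow_mat_diag_conj[OF Q] diag_conj_entry[OF q(2,3)])
  also have "\<dots> = (\<Sum>k<n. \<Sum>m\<le>degree p. coeff p m * (Q $$ (i,k) * a k ^ m * Qi $$ (k,j)))"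
    unfolding sum_distrib_left by (rule sum.swap)
  also have "\<dots> = (\<Sum>k<n. Q $$ (i,k) * poly p (a k) * Qi $$ (k,j))"
    by (simp add: poly_altdef sum_distrib_left sum_distrib_right mult_ac)
  finally show "poly_at_mat p A $$ (i,j) = (Q * mat_diag n (\<lambda>k. poly p (a k)) * Qi) $$ (i,j)"
    by (simp add: diag_conj_entry[OF q(2,3) ij])
qed (use similar_mat_diagD[OF Q] in \<open>auto simp: poly_at_mat_def mat_lincomb_def\<close>)

text \<open>
  The recursions that compute \<open>\<tau>\<^sub>i(A)\<close> and \<open>\<eta>\<^sub>i(A)\<close>: the first is applied to a column, the second to
  a row.
\<close>

lemma poly_at_mat_linear_factor:
  fixes A :: "'a::field mat"
  assumes Q: "similar_mat_wit A (mat_diag n a) Q Qi" and ij: "i < n" "j < n"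
  shows "poly_at_mat (p * [:- t, 1:]) A $$ (i,j) = (A * poly_at_mat p A) $$ (i,j) - t * poly_at_mat p A $$ (i,j)"
    and "poly_at_mat (p * [:- t, 1:]) A $$ (i,j) = (poly_at_mat p A * A) $$ (i,j) - t * poly_at_mat p A $$ (i,j)"
proof -
  note q = similar_mat_diagD[OF Q]
  let ?p = "poly_at_mat p A"
  have "A * ?p = (Q * mat_diag n a * Qi) * ?p" "?p * A = ?p * (Q * mat_diag n a * Qi)"
    using q(6) by simp_all
  then have "A * ?p = Q * mat_diag n (\<lambda>k. a k * poly p (a k)) * Qi"
    "?p * A = Q * mat_diag n (\<lambda>k. a k * poly p (a k)) * Qi"
    unfolding poly_at_mat_diag_conj[OF Q] by (simp_all add: diag_conj_mult[OF q(2,3,5)] mult.commute)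
  then show "poly_at_mat (p * [:- t, 1:]) A $$ (i,j) = (A * ?p) $$ (i,j) - t * ?p $$ (i,j)"
    "poly_at_mat (p * [:- t, 1:]) A $$ (i,j) = (?p * A) $$ (i,j) - t * ?p $$ (i,j)"
    unfolding poly_at_mat_diag_conj[OF Q]
    by (simp_all add: diag_conj_entry[OF q(2,3) ij] algebra_simps sum_distrib_left flip: sum_subtractf)
qed

section \<open>The tridiagonality criterion\<close>

lemma irreducible_tridiagonalI:
  assumes "T \<in> carrier_mat (d+1) (d+1)"
    and "\<And>i j. i + 1 < j \<Longrightarrow> j \<le> d \<Longrightarrow> T $$ (i,j) = 0" "\<And>i j. i + 1 < j \<Longrightarrow> j \<le> d \<Longrightarrow> T $$ (j,i) = 0"
    and "\<And>i. i + 1 \<le> d \<Longrightarrow> T $$ (i,i+1) \<noteq> 0" "\<And>i. i + 1 \<le> d \<Longrightarrow> T $$ (i+1,i) \<noteq> 0"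
  shows "irreducible_tridiagonal (d+1) T"
  unfolding irreducible_tridiagonal_def
proof (intro conjI allI impI)
  fix i j assume ij: "i < d + 1" "j < d + 1"
  show "T $$ (i,j) = 0" if "\<bar>int i - int j\<bar> > 1"
  proof (cases "i < j")
    case True then show ?thesis using assms(2)[of i j] ij that by auto
  next
    case False then show ?thesis using assms(3)[of j i] ij that by auto
  qed
  show "T $$ (i,j) \<noteq> 0" if "\<bar>int i - int j\<bar> = 1"
  proof (cases "i < j")
    case True
    then have "j = i + 1" using that by linarith
    then show ?thesis using assms(4)[of i] ij by simp
  next
    case False
    then have "i = j + 1" using that by linarith
    then show ?thesis using assms(5)[of j] ij by simp
  qed
qed (use assms in auto)

lemma irreducible_tridiagonalD:
  assumes "irreducible_tridiagonal n T"
  shows "T \<in> carrier_mat n n"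
    and "\<And>i j. i < n \<Longrightarrow> j < n \<Longrightarrow> \<bar>int i - int j\<bar> > 1 \<Longrightarrow> T $$ (i,j) = 0"
    and "\<And>i j. i < n \<Longrightarrow> j < n \<Longrightarrow> \<bar>int i - int j\<bar> = 1 \<Longrightarrow> T $$ (i,j) \<noteq> 0"
  using assms unfolding irreducible_tridiagonal_def by simp_all

text \<open>
  A walk on the integers with unit steps that never revisits a point can never turn around.
\<close>

lemma injective_unit_step_walk:
  fixes \<rho> :: "nat \<Rightarrow> int"
  assumes "inj_on \<rho> {..d}" "\<And>i. i < d \<Longrightarrow> \<bar>\<rho> (i+1) - \<rho> i\<bar> = 1"
  shows "\<exists>s. \<bar>s\<bar> = 1 \<and> (\<forall>i\<le>d. \<rho> i = \<rho> 0 + s * int i)"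
  using assms
proof (induction d)
  case 0
  then show ?case by (intro exI[of _ 1]) auto
next
  case (Suc d)
  have "inj_on \<rho> {..d}" using Suc.prems(1) by (rule inj_on_subset) auto
  with Suc obtain s where s: "\<bar>s\<bar> = 1" "\<And>i. i \<le> d \<Longrightarrow> \<rho> i = \<rho> 0 + s * int i"
    by auto
  have step: "\<bar>\<rho> (d+1) - \<rho> d\<bar> = 1" using Suc.prems(2)[of d] by simp
  show ?case
  proof (cases d)
    case 0
    then show ?thesis using step
      by (intro exI[of _ "\<rho> 1 - \<rho> 0"]) (auto simp: le_Suc_eq)
  next
    case (Suc d')
    have "\<rho> (d+1) \<noteq> \<rho> d'"
      using inj_onD[OF Suc.prems(1), of "d+1" d'] Suc by auto
    moreover have "\<rho> d = \<rho> d' + s"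
      using s(2)[of d] s(2)[of d'] Suc by (simp add: algebra_simps)
    ultimately have "\<rho> (d+1) = \<rho> d + s" using step s(1) by linarith
    then have "\<rho> i = \<rho> 0 + s * int i" if "i \<le> Suc d" for i
      using that s(2)[of i] s(2)[of d] by (auto simp: le_Suc_eq algebra_simps)
    then show ?thesis using s(1) by blast
  qed
qed

text \<open>
  The transpose of a lower bidiagonal matrix is upper bidiagonal, so this is the statement about
  tails (\<open>bidiagonal_hessenberg\<close>) applied to the transposed pair; \<open>R\<^sup>T\<close> inverts the eigenvector matrix of the upper
  bidiagonal matrix.
\<close>

lemma split_form_hessenberg:
  fixes R :: "'a::field mat" and a :: "nat \<Rightarrow> 'a"
  assumes R: "similar_mat_wit ((upper_bidiagonal d b c)\<^sup>T) (mat_diag (d+1) b) R Ri"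
    and low: "\<And>i j. i < j \<Longrightarrow> j \<le> d \<Longrightarrow> R $$ (i,j) = 0" and one: "\<And>i. i \<le> d \<Longrightarrow> R $$ (i,i) = 1"
  defines "T \<equiv> R\<^sup>T * lower_bidiagonal d a * Ri\<^sup>T"
  shows "i + 1 < j \<Longrightarrow> j \<le> d \<Longrightarrow> T $$ (j,i) = 0" and "i + 1 \<le> d \<Longrightarrow> T $$ (i+1,i) \<noteq> 0"
proof -
  let ?n = "d + 1" and ?U = "upper_bidiagonal d a (\<lambda>_. 1)"
  note r = similar_mat_diagD[OF R]
  have T: "T \<in> carrier_mat ?n ?n" using r by (auto simp: T_def)
  have "T\<^sup>T = Ri * (?U * R)"
    using r(2,3) by (simp add: T_def transpose_mult[of _ ?n ?n _ ?n] transpose_lower_bidiagonal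
      mult_carrier_mat[of _ "Suc d" "Suc d" _ "Suc d"])
  then have "?U * R = R * T\<^sup>T"
    using mult_inverse_cancel[OF r(4,2,3), of "?U * R" ?n] r(2) by (simp add: mult_carrier_mat[of _ "Suc d" "Suc d" _ "Suc d"])
  note h = bidiagonal_hessenberg[OF r(2) _ low _ _ this]
  show "T $$ (j,i) = 0" if "i + 1 < j" "j \<le> d"
    using h(1)[of i j] T one that by simp
  show "T $$ (i+1,i) \<noteq> 0" if "i + 1 \<le> d"
    using h(2)[of i] T one that by simp
qed

text \<open>
  Conjugating by \<open>Q\<close> turns the two idempotents into matrix units, which cut out a single entry.
\<close>

lemma idempotent_sandwich:
  fixes Q :: "'a::field mat"
  assumes Q: "Q \<in> carrier_mat n n" "Qi \<in> carrier_mat n n" "Qi * Q = 1\<^sub>m n" "B \<in> carrier_mat n n"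
    and ij: "i < n" "j < n"
  defines "D \<equiv> \<lambda>i. mat_diag n (\<lambda>k. if k = i then 1 else 0 :: 'a)"
  shows "(Q * D i * Qi) * B * (Q * D j * Qi) = 0\<^sub>m n n \<longleftrightarrow> (Qi * B * Q) $$ (i,j) = 0"
proof -
  note as = assoc_mult_mat[of _ n n _ n _ n] mult_carrier_mat[of _ n n _ n]
  define G where "G = D i * (Qi * B * Q) * D j"
  have D: "D i \<in> carrier_mat n n" for i by (simp add: D_def)
  have H: "Qi * B * Q \<in> carrier_mat n n" using Q by (simp add: as)
  have G: "G \<in> carrier_mat n n" using Q D H unfolding G_def by (simp add: as)
  have e: "G $$ (k,l) = (if k = i \<and> l = j then (Qi * B * Q) $$ (i,j) else 0)" if "k < n" "l < n" for k l
    unfolding G_def D_def using H that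
    by (simp add: mat_diag_mult_right_entry[of _ n n] mat_diag_mult_left_entry[of _ n n] as)
  have M: "(Q * D i * Qi) * B * (Q * D j * Qi) = Q * G * Qi"
    using Q(1,2,4) D by (simp add: G_def as)
  have "Qi * (Q * G * Qi) * Q = G"
    using mult_inverse_cancel[OF Q(3,2,1), where m = n] Q G by (simp add: as right_mult_one_mat[of _ n n])
  then have "Q * G * Qi = 0\<^sub>m n n \<longleftrightarrow> G = 0\<^sub>m n n"
    using Q(1,2) by auto
  also have "\<dots> \<longleftrightarrow> (Qi * B * Q) $$ (i,j) = 0"
    using e ij G by (auto simp: mat_eq_iff)
  finally show ?thesis by (simp only: M)
qed

text \<open>
  The columns of \<open>Q\<close> are eigenvectors of \<open>A\<close>. For the dual matrix the left eigenvectors, the rows of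
  \<open>R\<^sup>T\<close>, are taken as primary: then both eigenvector matrices are lower unitriangular and come
  from the same construction. The right eigenvectors of the dual matrix are the columns of \<open>Ri\<^sup>T\<close>.
\<close>

locale split_pair =
  fixes d :: nat and \<theta> \<theta>s vphi :: "nat \<Rightarrow> 'a::field" and Q Qi R Ri :: "'a mat"
  assumes \<theta>_distinct: "\<And>i j. i \<le> d \<Longrightarrow> j \<le> d \<Longrightarrow> i \<noteq> j \<Longrightarrow> \<theta> i \<noteq> \<theta> j"
    and \<theta>s_distinct: "\<And>i j. i \<le> d \<Longrightarrow> j \<le> d \<Longrightarrow> i \<noteq> j \<Longrightarrow> \<theta>s i \<noteq> \<theta>s j"
    and vphi_nonzero: "\<And>i. 1 \<le> i \<Longrightarrow> i \<le> d \<Longrightarrow> vphi i \<noteq> 0"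
    and Q_diag: "similar_mat_wit (lower_bidiagonal d \<theta>) (mat_diag (d+1) \<theta>) Q Qi"
    and Q_low: "\<And>i j. i < j \<Longrightarrow> j \<le> d \<Longrightarrow> Q $$ (i,j) = 0"
    and Q_one: "\<And>i. i \<le> d \<Longrightarrow> Q $$ (i,i) = 1"
    and R_diag: "similar_mat_wit ((upper_bidiagonal d \<theta>s vphi)\<^sup>T) (mat_diag (d+1) \<theta>s) R Ri"
    and R_low: "\<And>i j. i < j \<Longrightarrow> j \<le> d \<Longrightarrow> R $$ (i,j) = 0"
    and R_one: "\<And>i. i \<le> d \<Longrightarrow> R $$ (i,i) = 1"
begin

abbreviation "n \<equiv> d + 1"
abbreviation "A \<equiv> lower_bidiagonal d \<theta>"
abbreviation "As \<equiv> upper_bidiagonal d \<theta>s vphi"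

text \<open>
  \<open>T\<close> is \<open>A\<close> in the eigenbasis of \<open>As\<close>, and \<open>H\<close> is \<open>As\<close> in the eigenbasis of \<open>A\<close>, both in the order
  of the given eigenvalues.
\<close>

definition "T = R\<^sup>T * A * Ri\<^sup>T"
definition "H = Qi * As * Q"

lemma As_diag: "similar_mat_wit As (mat_diag n \<theta>s) (Ri\<^sup>T) (R\<^sup>T)"
  using transpose_similar_mat_wit[OF R_diag] by simp

lemmas Q_eigen = similar_mat_diagD[OF Q_diag]
lemmas R_eigen = similar_mat_diagD[OF R_diag]
lemmas P_eigen = similar_mat_diagD[OF As_diag]
lemmas square_assoc = assoc_mult_mat[of _ n n _ n _ n] mult_carrier_mat[of _ "Suc d" "Suc d" _ "Suc d"]

lemma T_carrier: "T \<in> carrier_mat n n"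
  using R_eigen by (auto simp: T_def)

lemma T_hessenberg: "i + 1 < j \<Longrightarrow> j \<le> d \<Longrightarrow> T $$ (j,i) = 0" "i + 1 \<le> d \<Longrightarrow> T $$ (i+1,i) \<noteq> 0"
  using split_form_hessenberg[OF R_diag R_low R_one] by (auto simp: T_def)

lemma H_carrier: "H \<in> carrier_mat n n"
  using Q_eigen by (auto simp: H_def)

lemma H_hessenberg: "i + 1 < j \<Longrightarrow> j \<le> d \<Longrightarrow> H $$ (i,j) = 0" "i + 1 \<le> d \<Longrightarrow> H $$ (i,i+1) \<noteq> 0"
proof -
  have "As * Q = Q * H"
    using mult_inverse_cancel[OF Q_eigen(4,2,3), of "As * Q" n] Q_eigen(2,3) by (simp add: H_def square_assoc)
  note h = bidiagonal_hessenberg[OF Q_eigen(2) H_carrier Q_low _ _ this]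
  show "i + 1 < j \<Longrightarrow> j \<le> d \<Longrightarrow> H $$ (i,j) = 0" "i + 1 \<le> d \<Longrightarrow> H $$ (i,i+1) \<noteq> 0"
    by (rule h; simp add: Q_one vphi_nonzero)+
qed

text \<open>
  The definition of a Leonard pair allows any order of the eigenvalues of \<open>As\<close>. Irreducible
  tridiagonality makes the nonzero off-diagonal pattern of \<open>T\<close> a path on the indices, while the
  nonzero subdiagonal makes each \<open>i\<close> adjacent to \<open>i + 1\<close>; so the path runs through the indices in
  increasing or decreasing order.
\<close>

lemma irreducible_T_of_leonard_pair:
  assumes "leonard_pair d A As"
  shows "irreducible_tridiagonal n T"
proof -
  obtain b R' Ri' where R': "similar_mat_wit As (mat_diag n b) R' Ri'"
    and T': "irreducible_tridiagonal n (Ri' * A * R')"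
    by (rule leonard_pair_eigenbasis[OF assms])
  note t' = irreducible_tridiagonalD[OF T']
  have dist: "\<And>i j. i < n \<Longrightarrow> j < n \<Longrightarrow> i \<noteq> j \<Longrightarrow> \<theta>s i \<noteq> \<theta>s j"
    using \<theta>s_distinct by simp
  obtain \<sigma> where \<sigma>: "bij_betw \<sigma> {..<n} {..<n}"
    and T: "\<And>i j. i < n \<Longrightarrow> j < n \<Longrightarrow> (Ri' * A * R') $$ (i,j) = 0 \<longleftrightarrow> T $$ (\<sigma> i, \<sigma> j) = 0"
    by (rule eigenbasis_change[OF As_diag R' dist]) (use Q_eigen(1) in \<open>auto simp: T_def\<close>)
  define \<rho> where "\<rho> = inv_into {..<n} \<sigma>"
  have \<rho>: "bij_betw \<rho> {..<n} {..<n}" unfolding \<rho>_def using \<sigma> by (rule bij_betw_inv_into)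
  have \<rho>_less: "\<rho> i < n" if "i < n" for i using \<rho> that by (auto simp: bij_betw_def)
  have \<sigma>\<rho>: "\<sigma> (\<rho> i) = i" if "i < n" for i
    using \<sigma> that by (auto simp: \<rho>_def bij_betw_def intro: f_inv_into_f)
  have T\<rho>: "T $$ (i,j) = 0 \<longleftrightarrow> (Ri' * A * R') $$ (\<rho> i, \<rho> j) = 0" if "i < n" "j < n" for i j
    using T[OF \<rho>_less[OF that(1)] \<rho>_less[OF that(2)]] unfolding \<sigma>\<rho>[OF that(1)] \<sigma>\<rho>[OF that(2)] by (rule sym)
  have "\<exists>s. \<bar>s\<bar> = 1 \<and> (\<forall>i\<le>d. int (\<rho> i) = int (\<rho> 0) + s * int i)"
  proof (rule injective_unit_step_walk)
    show "inj_on (\<lambda>i. int (\<rho> i)) {..d}"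
      using \<rho> by (auto simp: bij_betw_def inj_on_def lessThan_Suc_atMost)
    fix i assume i: "i < d"
    then have "(Ri' * A * R') $$ (\<rho> (i+1), \<rho> i) \<noteq> 0"
      using T\<rho>[of "i+1" i] T_hessenberg(2)[of i] by simp
    moreover have "\<rho> (i+1) \<noteq> \<rho> i"
      using \<sigma>\<rho>[of i] \<sigma>\<rho>[of "i+1"] i by auto
    ultimately show "\<bar>int (\<rho> (i+1)) - int (\<rho> i)\<bar> = 1"
      using t'(2)[of "\<rho> (i+1)" "\<rho> i"] \<rho>_less[of i] \<rho>_less[of "i+1"] i by linarith
  qed
  then obtain s where s: "\<bar>s\<bar> = 1" "\<And>i. i \<le> d \<Longrightarrow> int (\<rho> i) = int (\<rho> 0) + s * int i"
    by blast
  have dist_eq: "\<bar>int (\<rho> i) - int (\<rho> j)\<bar> = \<bar>int i - int j\<bar>" if "i \<le> d" "j \<le> d" for i j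
  proof -
    have "int (\<rho> i) - int (\<rho> j) = s * (int i - int j)"
      unfolding s(2)[OF that(1)] s(2)[OF that(2)] by (simp add: algebra_simps)
    then show ?thesis using s(1) by (simp add: abs_mult)
  qed
  show ?thesis
    unfolding irreducible_tridiagonal_def
  proof (intro conjI allI impI)
    fix i j assume ij: "i < n" "j < n"
    then have eq: "\<bar>int (\<rho> i) - int (\<rho> j)\<bar> = \<bar>int i - int j\<bar>" by (intro dist_eq) auto
    show "T $$ (i,j) = 0" if "\<bar>int i - int j\<bar> > 1"
      unfolding T\<rho>[OF ij] by (rule t'(2)) (use ij \<rho>_less eq that in auto)
    show "T $$ (i,j) \<noteq> 0" if "\<bar>int i - int j\<bar> = 1"
      unfolding T\<rho>[OF ij] by (rule t'(3)) (use ij \<rho>_less eq that in auto)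
  qed (rule T_carrier)
qed

text \<open>
  The given split form bounds \<open>T\<close> below the diagonal. The conjugated split form, in which the
  eigenvalues of \<open>As\<close> come in reverse order, gives the same bound for the reversed matrix, that is,
  above the diagonal of \<open>T\<close>.
\<close>

lemma irreducible_T_of_reverses:
  assumes "reverses_bidiagonal d A As \<theta>s X phi"
  shows "irreducible_tridiagonal n T"
proof -
  define B where "B = upper_bidiagonal d (\<lambda>i. \<theta>s (d - i)) (\<lambda>i. phi (d - i + 1))"
  obtain Y where X: "X \<in> carrier_mat n n" and Y: "Y \<in> carrier_mat n n"
    and XY: "X * Y = 1\<^sub>m n" "Y * X = 1\<^sub>m n" and A: "Y * A * X = A" and B: "Y * As * X = B"
    using assms by (auto simp: reverses_bidiagonal_def inverts_mat_def B_def)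
  have dist: "\<theta>s (d - i) \<noteq> \<theta>s (d - j)" if "i \<le> d" "j \<le> d" "i \<noteq> j" for i j
    using \<theta>s_distinct[of "d - i" "d - j"] that by auto
  obtain R' Ri' where R': "similar_mat_wit (B\<^sup>T) (mat_diag n (\<lambda>i. \<theta>s (d - i))) R' Ri'"
    and low': "\<And>i j. i < j \<Longrightarrow> j \<le> d \<Longrightarrow> R' $$ (i,j) = 0" and one': "\<And>i. i \<le> d \<Longrightarrow> R' $$ (i,i) = 1"
    unfolding B_def using bidiagonal_eigenmatrix[of d "\<lambda>i. \<theta>s (d - i)" "\<lambda>i. phi (d - i + 1)"] dist
    by metis
  note r' = similar_mat_diagD[OF R']
  have Bc: "B \<in> carrier_mat n n" by (simp add: B_def)
  have "similar_mat_wit B As Y X"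
    using X Y XY B Bc by (intro similar_mat_witI[of _ _ n]) auto
  then have "similar_mat_wit As B X Y" by (rule similar_mat_wit_sym)
  moreover have "similar_mat_wit B (mat_diag n (\<lambda>i. \<theta>s (d - i))) (Ri'\<^sup>T) (R'\<^sup>T)"
    using transpose_similar_mat_wit[OF R'] by simp
  ultimately have XR: "similar_mat_wit As (mat_diag n (\<lambda>i. \<theta>s (d - i))) (X * Ri'\<^sup>T) (R'\<^sup>T * Y)"
    by (rule similar_mat_wit_trans)
  have dist_s: "\<And>i j. i < n \<Longrightarrow> j < n \<Longrightarrow> i \<noteq> j \<Longrightarrow> \<theta>s i \<noteq> \<theta>s j"
    using \<theta>s_distinct by simp
  define T' where "T' = R'\<^sup>T * A * Ri'\<^sup>T"
  \<comment> \<open>Since X commutes with A, the columns of X times the eigenmatrix of B see the same A.\<close>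
  have T': "R'\<^sup>T * Y * A * (X * Ri'\<^sup>T) = T'"
  proof -
    have "R'\<^sup>T * Y * A * (X * Ri'\<^sup>T) = R'\<^sup>T * (Y * A * X) * Ri'\<^sup>T"
      using X Y r'(2,3) by (simp add: square_assoc)
    then show ?thesis by (simp only: A T'_def)
  qed
  obtain \<sigma> where \<sigma>: "bij_betw \<sigma> {..<n} {..<n}" and \<theta>\<sigma>: "\<And>j. j < n \<Longrightarrow> \<theta>s (d - j) = \<theta>s (\<sigma> j)"
    and T: "\<And>i j. i < n \<Longrightarrow> j < n \<Longrightarrow> T' $$ (i,j) = 0 \<longleftrightarrow> T $$ (\<sigma> i, \<sigma> j) = 0"
  proof (rule eigenbasis_change[OF As_diag XR dist_s])
    fix \<sigma> assume h: "bij_betw \<sigma> {..<n} {..<n}" "\<And>j. j < n \<Longrightarrow> \<theta>s (d - j) = \<theta>s (\<sigma> j)"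
      "\<And>A i j. A \<in> carrier_mat n n \<Longrightarrow> i < n \<Longrightarrow> j < n \<Longrightarrow>
        (R'\<^sup>T * Y * A * (X * Ri'\<^sup>T)) $$ (i,j) = 0 \<longleftrightarrow> (R\<^sup>T * A * Ri\<^sup>T) $$ (\<sigma> i, \<sigma> j) = 0"
    show thesis
      by (rule that[of \<sigma>]) (use h(1,2) h(3)[OF Q_eigen(1)] in \<open>auto simp only: T' T_def\<close>)
  qed
  have \<sigma>_eq: "\<sigma> j = d - j" if "j \<le> d" for j
  proof (rule ccontr)
    assume "\<sigma> j \<noteq> d - j"
    moreover have "\<sigma> j \<le> d"
      using bij_betwE[OF \<sigma>] that by (auto simp: less_Suc_eq_le)
    ultimately have "\<theta>s (d - j) \<noteq> \<theta>s (\<sigma> j)"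
      using \<theta>s_distinct[of "d - j" "\<sigma> j"] by auto
    then show False using \<theta>\<sigma>[of j] that by simp
  qed
  have flip: "T $$ (i,j) = 0 \<longleftrightarrow> T' $$ (d - i, d - j) = 0" if "i \<le> d" "j \<le> d" for i j
    using T[of "d - i" "d - j"] \<sigma>_eq[of "d - i"] \<sigma>_eq[of "d - j"] that by simp
  note h = split_form_hessenberg[OF R'[unfolded B_def] low' one', where a = \<theta>, folded T'_def]
  show ?thesis
  proof (rule irreducible_tridiagonalI)
    show "T $$ (i,j) = 0" if "i + 1 < j" "j \<le> d" for i j
      using flip[of i j] h(1)[of "d - j" "d - i"] that by simp
    show "T $$ (i,i+1) \<noteq> 0" if "i + 1 \<le> d" for i
    proof -
      have "d - i = d - (i+1) + 1" using that by simp
      then show ?thesis using flip[of i "i+1"] h(2)[of "d - (i+1)"] that by simp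
    qed
  qed (use T_hessenberg T_carrier in auto)
qed

lemma irreducible_H_of_irreducible_T:
  assumes "irreducible_tridiagonal n T"
  shows "irreducible_tridiagonal n H"
proof -
  have sym: "H $$ (i,j) = 0 \<longleftrightarrow> H $$ (j,i) = 0" if "i \<le> d" "j \<le> d" for i j
    unfolding H_def
    by (rule eigenbasis_pattern_symmetric[OF Q_diag As_diag]) (use that assms \<theta>_distinct in \<open>auto simp: T_def\<close>)
  show ?thesis
  proof (rule irreducible_tridiagonalI)
    show "H $$ (j,i) = 0" if "i + 1 < j" "j \<le> d" for i j
      using sym[of i j] H_hessenberg(1)[of i j] that by simp
    show "H $$ (i+1,i) \<noteq> 0" if "i + 1 \<le> d" for i
      using sym[of i "i+1"] H_hessenberg(2)[of i] that by simp
  qed (use H_hessenberg H_carrier in auto)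
qed

lemma leonard_pair_of_irreducible_T:
  assumes "irreducible_tridiagonal n T"
  shows "leonard_pair d A As"
  using leonard_pairI[OF Q_diag As_diag] assms irreducible_H_of_irreducible_T[OF assms]
  by (simp add: T_def H_def)

section \<open>Reversing the dual eigenvalues\<close>

text \<open>
  The vectors \<open>\<tau>\<^sub>i(A) v\<close>, where \<open>v\<close> is the eigenvector of \<open>As\<close> for the last dual eigenvalue; the
  step multiplies by the bidiagonal matrix \<open>A - \<theta>\<^sub>i\<close>. They play the role of \<open>e\<^sub>i = \<tau>\<^sub>i(A) e\<^sub>0\<close>, whose
  first member is an eigenvector for the first dual eigenvalue.
\<close>

primrec krylov :: "nat \<Rightarrow> nat \<Rightarrow> 'a" where
  "krylov 0 k = Ri\<^sup>T $$ (k,d)"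
| "krylov (Suc i) k = (\<theta> k - \<theta> i) * krylov i k + (if 0 < k then krylov i (k-1) else 0)"

lemma krylov_support: "k < i \<Longrightarrow> krylov i k = 0"
proof (induction i arbitrary: k)
  case (Suc i)
  then show ?case by (cases "k = i") auto
qed simp

definition "krylov_mat = mat n n (\<lambda>(k,i). krylov i k)"

lemma krylov_mat_carrier: "krylov_mat \<in> carrier_mat n n"
  by (simp add: krylov_mat_def)

text \<open>
  Columns \<open>i < d\<close> hold by the recursion. The last column needs \<open>(A - \<theta>\<^sub>d) \<tau>\<^sub>d(A) v = 0\<close>, which follows
  because each factor pushes the support down by one index.
\<close>

lemma krylov_mat_commute: "A * krylov_mat = krylov_mat * A"
proof (rule eq_matI)
  fix k i assume "k < dim_row (krylov_mat * A)" "i < dim_col (krylov_mat * A)"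
  then have ki: "k \<le> d" "i \<le> d" by (auto simp: krylov_mat_def lower_bidiagonal_def)
  have "\<theta> k * krylov i k + (if 0 < k then krylov i (k-1) else 0) = krylov i k * \<theta> i + krylov (Suc i) k"
    by (simp add: algebra_simps)
  also have "krylov (Suc i) k = (if i + 1 \<le> d then krylov (Suc i) k else 0)"
    using ki krylov_support[of k "Suc d"] by (cases "i = d") (auto simp del: krylov.simps)
  finally show "(A * krylov_mat) $$ (k,i) = (krylov_mat * A) $$ (k,i)"
    unfolding lower_bidiagonal_mult_left[OF krylov_mat_carrier ki] lower_bidiagonal_mult_right[OF krylov_mat_carrier ki]
    using ki by (auto simp: krylov_mat_def simp del: krylov.simps split: if_splits)
qed (auto simp: krylov_mat_def lower_bidiagonal_def)

text \<open>
  Let \<open>X\<close> have the vectors \<open>f\<^sub>i = \<tau>\<^sub>i(A) v\<close> as columns. As \<open>T\<close> is irreducible tridiagonal, \<open>f\<^sub>0, \<dots>, f\<^sub>i\<close>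
  span the sum of the eigenspaces of \<open>As\<close> for the last \<open>i + 1\<close> dual eigenvalues; hence \<open>X\<close> is
  invertible and \<open>B = X\<^sup>-\<^sup>1 As X\<close> is upper triangular with reversed diagonal. As \<open>X\<close> is also lower
  triangular, \<open>B\<close> has the shape of \<open>As\<close> above the diagonal. The two bounds leave an upper bidiagonal
  matrix with nonzero superdiagonal.
\<close>

lemma ex_reverses_of_irreducible_T:
  assumes T: "irreducible_tridiagonal n T"
  shows "\<exists>X phi. reverses_bidiagonal d A As \<theta>s X phi"
proof -
  note t = irreducible_tridiagonalD[OF T]
  define W where "W = R\<^sup>T * krylov_mat"
  have W: "W \<in> carrier_mat n n" using P_eigen(3) krylov_mat_carrier by (simp add: W_def square_assoc)
  have TW: "T * W = W * A"
  proof -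
    have "T * W = R\<^sup>T * (A * krylov_mat)"
      using mult_inverse_cancel[OF P_eigen(4,2,3) krylov_mat_carrier] P_eigen(2,3) Q_eigen(1) krylov_mat_carrier
      by (simp add: T_def W_def square_assoc)
    then show ?thesis using P_eigen(3) Q_eigen(1) krylov_mat_carrier by (simp add: krylov_mat_commute W_def square_assoc)
  qed
  have W0: "W $$ (k,0) = (if k = d then 1 else 0)" if "k \<le> d" for k
  proof -
    have "W $$ (k,0) = (\<Sum>l<n. R\<^sup>T $$ (k,l) * krylov_mat $$ (l,0))"
      unfolding W_def by (rule mat_mult_entry[OF P_eigen(3) krylov_mat_carrier]) (use that in auto)
    also have "\<dots> = (\<Sum>l<n. R\<^sup>T $$ (k,l) * Ri\<^sup>T $$ (l,d))"
      by (simp add: krylov_mat_def)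
    also have "\<dots> = (R\<^sup>T * Ri\<^sup>T) $$ (k,d)"
      by (rule mat_mult_entry[OF P_eigen(3,2), symmetric]) (use that in auto)
    finally show ?thesis unfolding P_eigen(5) using that by auto
  qed
  have W_step: "W $$ (k,i+1) = (\<Sum>l<n. T $$ (k,l) * W $$ (l,i)) - W $$ (k,i) * \<theta> i"
    if "k \<le> d" "i + 1 \<le> d" for k i
  proof -
    have "(\<Sum>l<n. T $$ (k,l) * W $$ (l,i)) = (W * A) $$ (k,i)"
      unfolding TW[symmetric] by (rule mat_mult_entry[OF t(1) W, symmetric]) (use that in auto)
    then show ?thesis using W that by (subst (asm) lower_bidiagonal_mult_right) auto
  qed
  \<comment> \<open>Each step climbs exactly one place, because the superdiagonal of T does not vanish.\<close>
  have W_anti: "(\<forall>k<d-i. W $$ (k,i) = 0) \<and> W $$ (d-i,i) \<noteq> 0" if "i \<le> d" for i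
    using that
  proof (induction i)
    case 0
    then show ?case using W0 by auto
  next
    case (Suc i)
    then have IH: "\<And>k. k < d - i \<Longrightarrow> W $$ (k,i) = 0" "W $$ (d-i,i) \<noteq> 0" by auto
    have "W $$ (k, Suc i) = 0" if "k < d - Suc i" for k
    proof -
      have "T $$ (k,l) * W $$ (l,i) = 0" if "l < n" for l
        using IH(1)[of l] t(2)[of k l] \<open>k < d - Suc i\<close> that by (cases "l < d - i") auto
      then have "(\<Sum>l<n. T $$ (k,l) * W $$ (l,i)) = 0" by (intro sum.neutral) auto
      then show ?thesis using W_step[of k i] that Suc.prems IH(1)[of k] by simp
    qed
    moreover have "W $$ (d - Suc i, Suc i) \<noteq> 0"
    proof -
      let ?k = "d - Suc i"
      have k: "d - i = ?k + 1" "?k + 1 < n" using Suc.prems by auto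
      have "(\<Sum>l<n. T $$ (?k,l) * W $$ (l,i)) = (\<Sum>l\<in>{?k+1}. T $$ (?k,l) * W $$ (l,i))"
      proof (rule sum.mono_neutral_right)
        show "\<forall>l\<in>{..<n} - {?k+1}. T $$ (?k,l) * W $$ (l,i) = 0"
        proof
          fix l assume "l \<in> {..<n} - {?k+1}"
          then show "T $$ (?k,l) * W $$ (l,i) = 0"
            using IH(1)[of l] t(2)[of ?k l] k by (cases "l < d - i") auto
        qed
      qed (use k in auto)
      then have "W $$ (?k, Suc i) = T $$ (?k,?k+1) * W $$ (d-i,i)"
        using W_step[of ?k i] IH(1)[of ?k] k Suc.prems by simp
      moreover have "T $$ (?k,?k+1) \<noteq> 0" using t(3)[of ?k "?k+1"] k by simp
      ultimately show ?thesis using IH(2) by simp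
    qed
    ultimately show ?case by blast
  qed
  \<comment> \<open>J reverses the order of the basis and turns W into a lower triangular matrix.\<close>
  define J where "J = mat n n (\<lambda>(i,j). if j = d - i then 1 else 0 :: 'a)"
  have J: "J \<in> carrier_mat n n" by (simp add: J_def)
  have MJ: "(M * J) $$ (i,j) = M $$ (i,d-j)" if "M \<in> carrier_mat n n" "i \<le> d" "j \<le> d" for M i j
  proof -
    have "(M * J) $$ (i,j) = (\<Sum>l<n. M $$ (i,l) * J $$ (l,j))"
      using that by (intro mat_mult_entry[OF _ J]) auto
    also have "\<dots> = (\<Sum>l\<in>{d-j}. M $$ (i,l) * J $$ (l,j))"
      by (rule sum.mono_neutral_right) (use that in \<open>auto simp: J_def\<close>)
    finally show ?thesis using that by (simp add: J_def)
  qed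
  have JM: "(J * M) $$ (i,j) = M $$ (d-i,j)" if "M \<in> carrier_mat n n" "i \<le> d" "j \<le> d" for M i j
  proof -
    have "(J * M) $$ (i,j) = (\<Sum>l<n. J $$ (i,l) * M $$ (l,j))"
      using that by (intro mat_mult_entry[OF J]) auto
    also have "\<dots> = (\<Sum>l\<in>{d-i}. J $$ (i,l) * M $$ (l,j))"
      by (rule sum.mono_neutral_right) (use that in \<open>auto simp: J_def\<close>)
    finally show ?thesis using that by (simp add: J_def)
  qed
  have JJ: "J * J = 1\<^sub>m n"
  proof (rule eq_matI)
    fix i j assume "i < dim_row (1\<^sub>m n)" "j < dim_col (1\<^sub>m n)"
    then have ij: "i \<le> d" "j \<le> d" by auto
    then show "(J * J) $$ (i,j) = 1\<^sub>m n $$ (i,j)"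
      unfolding MJ[OF J ij] by (auto simp: J_def)
  qed (use J in auto)
  define V where "V = W * J"
  have V: "V \<in> carrier_mat n n" using W J by (simp add: V_def square_assoc)
  have V_entry: "V $$ (i,j) = W $$ (i,d-j)" if "i \<le> d" "j \<le> d" for i j
    unfolding V_def using MJ[OF W that] .
  have V_low: "\<And>i j. i < j \<Longrightarrow> j < n \<Longrightarrow> V $$ (i,j) = 0" and V_diag: "\<And>i. i < n \<Longrightarrow> V $$ (i,i) \<noteq> 0"
  proof -
    fix i j assume "i < j" "j < n"
    then show "V $$ (i,j) = 0" using W_anti[of "d-j"] by (simp add: V_entry)
  next
    fix i assume "i < n"
    then show "V $$ (i,i) \<noteq> 0" using W_anti[of "d-i"] by (simp add: V_entry)
  qed
  have "det V \<noteq> 0" using V V_low V_diag by (rule det_lower_triangular_nonzero)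
  then have det: "det krylov_mat \<noteq> 0"
    using W J P_eigen(3) krylov_mat_carrier by (simp add: V_def W_def det_mult[of _ "Suc d"])
  then obtain Y where Y: "Y \<in> carrier_mat n n" "krylov_mat * Y = 1\<^sub>m n" "Y * krylov_mat = 1\<^sub>m n"
    using ex_inverse_of_det_nonzero[OF krylov_mat_carrier] by blast
  have X_low: "\<And>i j. i < j \<Longrightarrow> j < n \<Longrightarrow> krylov_mat $$ (i,j) = 0"
    by (simp add: krylov_mat_def krylov_support)
  have X_diag: "krylov_mat $$ (i,i) \<noteq> 0" if "i < n" for i
  proof -
    have "0 \<notin> set (diag_mat krylov_mat)"
      using det det_lower_triangular[OF X_low krylov_mat_carrier] by (simp add: prod_list_zero_iff)
    moreover have "krylov_mat $$ (i,i) \<in> set (diag_mat krylov_mat)"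
      using that krylov_mat_carrier by (auto simp: diag_mat_def simp del: upt_Suc)
    ultimately show ?thesis by metis
  qed
  define B where "B = Y * As * krylov_mat"
  have B: "B \<in> carrier_mat n n" using Y(1) P_eigen(1) krylov_mat_carrier by (simp add: B_def square_assoc)
  have XB: "As * krylov_mat = krylov_mat * B"
    using mult_inverse_cancel[OF Y(2) krylov_mat_carrier Y(1), of "As * krylov_mat" n] krylov_mat_carrier Y(1) P_eigen(1)
    by (simp add: B_def square_assoc)
  have hess: "\<And>i j. i + 1 < j \<Longrightarrow> j \<le> d \<Longrightarrow> B $$ (i,j) = 0" "\<And>i. i + 1 \<le> d \<Longrightarrow> B $$ (i,i+1) \<noteq> 0"
    using bidiagonal_hessenberg[OF krylov_mat_carrier B _ _ _ XB] X_low X_diag vphi_nonzero by auto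
  define S where "S = J * B * J"
  have S: "S \<in> carrier_mat n n" using B J by (simp add: S_def square_assoc)
  have "W * B = mat_diag n \<theta>s * W"
    using P_eigen(1,3) krylov_mat_carrier B similar_mat_diag_push(4)[OF As_diag krylov_mat_carrier]
    by (simp add: W_def square_assoc flip: XB)
  then have VS: "V * S = mat_diag n \<theta>s * V"
  proof -
    assume WB: "W * B = mat_diag n \<theta>s * W"
    have "V * S = (W * B) * J"
      using mult_inverse_cancel[OF JJ J J, where m = n] W J B by (simp add: V_def S_def square_assoc)
    then show ?thesis unfolding WB V_def using W J by (simp add: square_assoc)
  qed
  have VS_entry: "(V * S) $$ (i,j) = \<theta>s i * V $$ (i,j)" if "i < n" "j < n" for i j
    unfolding VS using V that by (simp add: mat_diag_mult_left_entry[of _ "Suc d" "Suc d"])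
  have S_entry: "S $$ (i,j) = B $$ (d-i,d-j)" if "i \<le> d" "j \<le> d" for i j
    unfolding S_def using MJ[of "J * B" i j] JM[OF B, of i "d-j"] J B that by (simp add: square_assoc)
  have S_low: "S $$ (i,j) = 0" if "i < j" "j < n" for i j
    by (rule lower_triangular_solve(1)[OF V S V_low V_diag, of j j]) (use that VS_entry V_low in auto)
  have S_diag: "S $$ (j,j) = \<theta>s j" if "j < n" for j
  proof -
    have "(V * S) $$ (j,j) = V $$ (j,j) * S $$ (j,j)"
      by (rule lower_triangular_solve(2)[OF V S V_low V_diag]) (use that VS_entry V_low in auto)
    then show ?thesis using VS_entry[of j j] V_diag[of j] that by simp
  qed
  define phi where "phi = (\<lambda>m. B $$ (d - m, d - m + 1))"
  have "B = upper_bidiagonal d (\<lambda>i. \<theta>s (d - i)) (\<lambda>i. phi (d - i + 1))"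
  proof (rule eq_matI)
    fix i j assume "i < dim_row (upper_bidiagonal d (\<lambda>i. \<theta>s (d - i)) (\<lambda>i. phi (d - i + 1)))"
      "j < dim_col (upper_bidiagonal d (\<lambda>i. \<theta>s (d - i)) (\<lambda>i. phi (d - i + 1)))"
    then have ij: "i \<le> d" "j \<le> d" by simp_all
    have BS: "B $$ (i,j) = S $$ (d-i,d-j)" using S_entry[of "d-i" "d-j"] ij by simp
    consider "j < i" | "j = i" | "j = i + 1" | "i + 1 < j" by linarith
    then show "B $$ (i,j) = upper_bidiagonal d (\<lambda>i. \<theta>s (d - i)) (\<lambda>i. phi (d - i + 1)) $$ (i,j)"
    proof cases
      case 1
      then show ?thesis using BS S_low[of "d-i" "d-j"] ij by (simp add: upper_bidiagonal_entry)
    next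
      case 2
      then show ?thesis using BS S_diag[of "d-i"] ij by (simp add: upper_bidiagonal_entry)
    next
      case 3
      then have "d - (d - j + 1) = i" using ij by simp
      then show ?thesis using 3 ij by (simp add: upper_bidiagonal_entry phi_def)
    next
      case 4
      then show ?thesis using hess(1) ij by (simp add: upper_bidiagonal_entry)
    qed
  qed (use B in auto)
  moreover have "phi i \<noteq> 0" if "i \<in> {1..d}" for i
    unfolding phi_def by (rule hess(2)) (use that in auto)
  moreover have "Y * A * krylov_mat = A"
    using mult_inverse_cancel[OF Y(3,1) krylov_mat_carrier Q_eigen(1)] Y(1) krylov_mat_carrier Q_eigen(1)
    by (simp add: square_assoc krylov_mat_commute)
  ultimately show ?thesis
    using krylov_mat_carrier Y unfolding reverses_bidiagonal_def inverts_mat_def B_def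
    by (intro exI[of _ krylov_mat] exI[of _ phi]) auto
qed

section \<open>The Leonard system, its split sequences and its switching element\<close>

lemma \<theta>_inj: "inj_on \<theta> {..d}" and \<theta>s_inj: "inj_on \<theta>s {..d}"
  using \<theta>_distinct \<theta>s_distinct by (auto simp: inj_on_def)

lemma primitive_idempotents:
  assumes "i \<le> d"
  shows "primitive_idempotent d A \<theta> i = Q * mat_diag n (\<lambda>k. if k = i then 1 else 0) * Qi"
    and "primitive_idempotent d As \<theta>s i = Ri\<^sup>T * mat_diag n (\<lambda>k. if k = i then 1 else 0) * R\<^sup>T"
proof -
  have "mat_diag n (\<lambda>k. if \<theta> k = \<theta> i then 1 else 0) = (mat_diag n (\<lambda>k. if k = i then 1 else 0) :: 'a mat)"
    using assms \<theta>_distinct by (intro eq_matI) (auto simp: mat_diag_def less_Suc_eq_le)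
  then show "primitive_idempotent d A \<theta> i = Q * mat_diag n (\<lambda>k. if k = i then 1 else 0) * Qi"
    using primitive_idempotent_diag[OF Q_diag \<theta>_inj] assms by simp
  have "mat_diag n (\<lambda>k. if \<theta>s k = \<theta>s i then 1 else 0) = (mat_diag n (\<lambda>k. if k = i then 1 else 0) :: 'a mat)"
    using assms \<theta>s_distinct by (intro eq_matI) (auto simp: mat_diag_def less_Suc_eq_le)
  then show "primitive_idempotent d As \<theta>s i = Ri\<^sup>T * mat_diag n (\<lambda>k. if k = i then 1 else 0) * R\<^sup>T"
    using primitive_idempotent_diag[OF As_diag \<theta>s_inj] assms by simp
qed

context
  fixes E Es :: "nat \<Rightarrow> 'a mat"
  assumes E: "\<And>i. i \<le> d \<Longrightarrow> E i = primitive_idempotent d A \<theta> i"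
    and Es: "\<And>i. i \<le> d \<Longrightarrow> Es i = primitive_idempotent d As \<theta>s i"
begin

lemma leonard_system_of_irreducible_T:
  assumes T: "irreducible_tridiagonal n T"
  shows "leonard_system d (A, E, As, Es)"
proof -
  have EE: "E i * As * E j = 0\<^sub>m n n \<longleftrightarrow> H $$ (i,j) = 0" if "i \<le> d" "j \<le> d" for i j
    using that idempotent_sandwich[OF Q_eigen(2,3,5) P_eigen(1)] by (simp add: E primitive_idempotents H_def)
  have EEs: "Es i * A * Es j = 0\<^sub>m n n \<longleftrightarrow> T $$ (i,j) = 0" if "i \<le> d" "j \<le> d" for i j
    using that idempotent_sandwich[OF P_eigen(2,3,5) Q_eigen(1)] by (simp add: Es primitive_idempotents T_def)
  note t = irreducible_tridiagonalD[OF T]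
  note h = irreducible_tridiagonalD[OF irreducible_H_of_irreducible_T[OF T]]
  have "idempotent_ordering d A E" "idempotent_ordering d As Es"
    using eigenvalue_ordering_diag(1)[OF Q_diag \<theta>_inj] eigenvalue_ordering_diag(1)[OF As_diag \<theta>s_inj] E Es
    unfolding idempotent_ordering_def by blast+
  moreover have "multiplicity_free d A" "multiplicity_free d As"
    using eigenvalue_ordering_diag(2)[OF Q_diag \<theta>_inj] eigenvalue_ordering_diag(2)[OF As_diag \<theta>s_inj] by auto
  ultimately show ?thesis
    unfolding leonard_system.simps using EE EEs t(2,3) h(2,3) by (simp add: less_Suc_eq_le)
qed

lemma eigenvalue_seqs:
  assumes "i \<le> d"
  shows "eigenvalue_seq d (A, E, As, Es) i = \<theta> i" "dual_eigenvalue_seq d (A, E, As, Es) i = \<theta>s i"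
  using assms idempotent_eigenvalue_diag[OF Q_diag \<theta>_inj] idempotent_eigenvalue_diag[OF As_diag \<theta>s_inj]
  by (simp_all add: E Es)

text \<open>
  Column \<open>0\<close> of \<open>R\<close> is the left eigenvector \<open>w\<close> of \<open>As\<close> for \<open>\<theta>s 0\<close>, with \<open>w\<^sub>0 = 1\<close>. Its recursion is
  exactly the one that the split sequence prescribes for the traces.
\<close>

lemma left_eigenvector: "0 < i \<Longrightarrow> i \<le> d \<Longrightarrow> (\<theta>s 0 - \<theta>s i) * R $$ (i,0) = vphi i * R $$ (i-1,0)"
proof -
  assume i: "0 < i" "i \<le> d"
  have "((upper_bidiagonal d \<theta>s vphi)\<^sup>T * R) $$ (i,0) = (R * mat_diag n \<theta>s) $$ (i,0)"
    by (simp only: R_eigen(7))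
  then have "\<theta>s i * R $$ (i,0) + vphi i * R $$ (i-1,0) = R $$ (i,0) * \<theta>s 0"
    using i R_eigen(2) by (simp add: transpose_bidiagonal_mult_left mat_diag_mult_right_entry[of _ "Suc d" "Suc d"])
  then show ?thesis by (simp add: algebra_simps)
qed

lemma left_eigenvector_nonzero: "i \<le> d \<Longrightarrow> R $$ (i,0) \<noteq> 0"
proof (induction i)
  case (Suc i)
  then show ?case using left_eigenvector[of "Suc i"] vphi_nonzero[of "Suc i"] by auto
qed (simp add: R_one)

text \<open>
  \<open>Es 0 = e\<^sub>0 w\<^sup>T\<close>, since \<open>e\<^sub>0\<close> is the right eigenvector of \<open>As\<close> for \<open>\<theta>s 0\<close>. Hence traces against
  \<open>Es 0\<close> only see column \<open>0\<close> of the other factor.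
\<close>

lemma Es0_entry:
  assumes "k \<le> d" "l \<le> d"
  shows "Es 0 $$ (k,l) = (if k = 0 then R $$ (l,0) else 0)"
proof -
  have Ri0: "Ri $$ (0,k) = (if k = 0 then 1 else 0)"
  proof -
    have "(R * Ri) $$ (0,k) = (\<Sum>m<n. R $$ (0,m) * Ri $$ (m,k))"
      by (rule mat_mult_entry[OF R_eigen(2,3)]) (use assms in auto)
    also have "\<dots> = (\<Sum>m\<in>{0}. R $$ (0,m) * Ri $$ (m,k))"
      by (rule sum.mono_neutral_right) (use R_low in auto)
    finally show ?thesis using assms R_one[of 0] by (simp add: R_eigen(4))
  qed
  have "Es 0 $$ (k,l) = (\<Sum>m<n. Ri\<^sup>T $$ (k,m) * (if m = 0 then 1 else 0) * R\<^sup>T $$ (m,l))"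
    using assms diag_conj_entry[OF P_eigen(2,3), of k l] by (simp add: Es primitive_idempotents)
  also have "\<dots> = (\<Sum>m\<in>{0}. Ri\<^sup>T $$ (k,m) * (if m = 0 then 1 else 0) * R\<^sup>T $$ (m,l))"
    by (rule sum.mono_neutral_right) auto
  finally show ?thesis using assms R_eigen(2,3) Ri0 by simp
qed

lemma trace_mult_Es0:
  assumes M: "M \<in> carrier_mat n n"
  shows "mat_trace (M * Es 0) = (\<Sum>i<n. M $$ (i,0) * R $$ (i,0))"
proof -
  have Es0: "Es 0 \<in> carrier_mat n n"
    using P_eigen(2,3) by (simp add: Es primitive_idempotents square_assoc)
  have "(M * Es 0) $$ (i,i) = M $$ (i,0) * R $$ (i,0)" if "i < n" for i
  proof -
    have "(M * Es 0) $$ (i,i) = (\<Sum>k<n. M $$ (i,k) * Es 0 $$ (k,i))"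
      by (rule mat_mult_entry[OF M Es0 that that])
    also have "\<dots> = (\<Sum>k\<in>{0}. M $$ (i,k) * Es 0 $$ (k,i))"
      by (rule sum.mono_neutral_right) (use that Es0_entry in auto)
    finally show ?thesis using that by (simp add: Es0_entry)
  qed
  then show ?thesis using M by (simp add: mat_trace_def)
qed

lemma poly_at_A_carrier: "poly_at_mat f A \<in> carrier_mat n n"
  using Q_eigen(2,3) by (simp add: poly_at_mat_diag_conj[OF Q_diag] square_assoc)

lemma poly_at_A_one: "poly_at_mat 1 A = 1\<^sub>m n"
  using Q_eigen(2,3,4) by (simp add: poly_at_mat_diag_conj[OF Q_diag] right_mult_one_mat[of _ "Suc d" "Suc d"])

text \<open>
  \<open>\<tau>\<^sub>i(A) e\<^sub>0 = e\<^sub>i\<close>, because \<open>A e\<^sub>i = \<theta>\<^sub>i e\<^sub>i + e\<^sub>i\<^sub>+\<^sub>1\<close>.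
\<close>

lemma tau_column:
  assumes "i \<le> d" "k \<le> d"
  shows "poly_at_mat (tau \<theta> i) A $$ (k,0) = (if k = i then 1 else 0)"
  using assms
proof (induction i arbitrary: k)
  case 0
  then show ?case by (simp add: tau_def poly_at_A_one)
next
  case (Suc i)
  let ?p = "poly_at_mat (tau \<theta> i) A"
  have "poly_at_mat (tau \<theta> (Suc i)) A $$ (k,0) = (A * ?p) $$ (k,0) - \<theta> i * ?p $$ (k,0)"
    using poly_at_mat_linear_factor(1)[OF Q_diag, of k 0] Suc.prems by (simp add: tau_def mult.commute)
  also have "(A * ?p) $$ (k,0) = \<theta> k * ?p $$ (k,0) + (if 0 < k then ?p $$ (k-1,0) else 0)"
    using Suc.prems by (intro lower_bidiagonal_mult_left poly_at_A_carrier) auto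
  finally show ?case using Suc by auto
qed

text \<open>
  The mirror image for rows: \<open>e\<^sub>d\<^sup>T \<eta>\<^sub>i(A) = e\<^sub>d\<^sub>-\<^sub>i\<^sup>T\<close>.
\<close>

lemma eta_row:
  assumes "i \<le> d" "k \<le> d"
  shows "poly_at_mat (eta d \<theta> i) A $$ (d,k) = (if k = d - i then 1 else 0)"
  using assms
proof (induction i arbitrary: k)
  case 0
  then show ?case by (simp add: eta_def poly_at_A_one)
next
  case (Suc i)
  let ?p = "poly_at_mat (eta d \<theta> i) A"
  have "poly_at_mat (eta d \<theta> (Suc i)) A $$ (d,k) = (?p * A) $$ (d,k) - \<theta> (d - i) * ?p $$ (d,k)"
    using poly_at_mat_linear_factor(2)[OF Q_diag, of d k] Suc.prems by (simp add: eta_def mult.commute)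
  also have "(?p * A) $$ (d,k) = ?p $$ (d,k) * \<theta> k + (if k + 1 \<le> d then ?p $$ (d,k+1) else 0)"
    using Suc.prems by (intro lower_bidiagonal_mult_right poly_at_A_carrier) auto
  finally show ?case using Suc by auto
qed

lemma first_split_seq_eq:
  assumes i: "1 \<le> i" "i \<le> d"
  shows "first_split_seq d (A, E, As, Es) i = vphi i"
proof -
  have tr: "mat_trace (poly_at_mat (tau (eigenvalue_seq d (A, E, As, Es)) j) A * Es 0) = R $$ (j,0)"
    if "j \<le> d" for j
  proof -
    have "tau (eigenvalue_seq d (A, E, As, Es)) j = tau \<theta> j"
      unfolding tau_def by (rule prod.cong) (use that eigenvalue_seqs in auto)
    moreover have "(\<Sum>k<n. poly_at_mat (tau \<theta> j) A $$ (k,0) * R $$ (k,0)) = (\<Sum>k\<in>{j}. 1 * R $$ (k,0))"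
      by (rule sum.mono_neutral_cong_right) (use that in \<open>auto simp: tau_column less_Suc_eq_le\<close>)
    ultimately show ?thesis by (simp only: trace_mult_Es0[OF poly_at_A_carrier]) simp
  qed
  have "first_split_seq d (A, E, As, Es) i = (\<theta>s 0 - \<theta>s i) * R $$ (i,0) / R $$ (i-1,0)"
    unfolding first_split_seq.simps Let_def using i eigenvalue_seqs(2) by (simp add: tr)
  then show ?thesis using left_eigenvector[of i] left_eigenvector_nonzero[of "i-1"] i by simp
qed

text \<open>
  The commutant of a matrix with simple spectrum consists of its spectral combinations.
\<close>

lemma commuting_diag:
  assumes X: "X \<in> carrier_mat n n" and comm: "X * A = A * X"
  shows "X = Q * mat_diag n (\<lambda>k. (Qi * X * Q) $$ (k,k)) * Qi"
proof -
  define N where "N = Qi * X * Q"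
  have N: "N \<in> carrier_mat n n" using X Q_eigen(2,3) by (simp add: N_def square_assoc)
  have "N * mat_diag n \<theta> = Qi * (X * A) * Q"
    using X Q_eigen(1,2,3) by (simp add: N_def square_assoc Q_eigen(7))
  also have "\<dots> = mat_diag n \<theta> * N"
    unfolding comm using X Q_eigen(1,2,3) similar_mat_diag_push(4)[OF Q_diag, of "X * Q" n] by (simp add: N_def square_assoc)
  finally have "N = mat_diag n (\<lambda>k. N $$ (k,k))"
    using N \<theta>_distinct by (intro commutes_with_distinct_diag) auto
  moreover have "Q * N * Qi = X"
    using X Q_eigen(2,3,4) mult_inverse_cancel[OF Q_eigen(4,2,3), where m = n]
    by (simp add: N_def square_assoc right_mult_one_mat[of _ "Suc d" "Suc d"])
  ultimately show ?thesis unfolding N_def by metis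
qed

text \<open>
  A matrix \<open>X\<close> as in the second condition, with inverse \<open>Y\<close> and conjugated dual matrix \<open>B\<close>.
\<close>

context
  fixes X Y B phi
  assumes X: "X \<in> carrier_mat n n" and Y: "Y \<in> carrier_mat n n"
    and XY: "X * Y = 1\<^sub>m n" "Y * X = 1\<^sub>m n"
    and comm: "X * A = A * X"
    and B: "B = upper_bidiagonal d (\<lambda>i. \<theta>s (d - i)) (\<lambda>i. phi (d - i + 1))"
    and XB: "As * X = X * B"
    and phi_nonzero: "\<And>i. 1 \<le> i \<Longrightarrow> i \<le> d \<Longrightarrow> phi i \<noteq> 0"
begin

lemma B_carrier: "B \<in> carrier_mat n n"
  by (simp add: B)

text \<open>
  Write \<open>w\<close> for the left eigenvector. The row \<open>w\<^sup>T X\<close> is a left eigenvector of \<open>B\<close> for \<open>\<theta>s 0\<close>, which is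
  the last diagonal entry of \<open>B\<close>; so it is a multiple of \<open>e\<^sub>d\<^sup>T\<close>. As \<open>\<eta>\<^sub>i(A)\<close> commutes with \<open>X\<close>, it
  follows that \<open>w\<^sup>T \<eta>\<^sub>i(A)\<close> is the same multiple of row \<open>d - i\<close> of \<open>Y\<close>.
\<close>

lemma eta_trace:
  assumes i: "i \<le> d"
  shows "mat_trace (poly_at_mat (eta d \<theta> i) A * Es 0) = (R\<^sup>T * X) $$ (0,d) * Y $$ (d-i,0)"
proof -
  define U where "U = R\<^sup>T * X"
  let ?N = "poly_at_mat (eta d \<theta> i) A"
  have U: "U \<in> carrier_mat n n" using P_eigen(3) X by (simp add: U_def square_assoc)
  note N = poly_at_A_carrier[of "eta d \<theta> i"]
  have UB: "U * B = mat_diag n \<theta>s * U"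
    using P_eigen(1,3) X B_carrier similar_mat_diag_push(4)[OF As_diag X] by (simp add: U_def square_assoc flip: XB)
  have U0: "U $$ (0,k) = 0" if "k < d" for k
    using that
  proof (induction k)
    case 0
    have "(U * B) $$ (0,0) = \<theta>s 0 * U $$ (0,0)"
      unfolding UB using U by (simp add: mat_diag_mult_left_entry[of _ "Suc d" "Suc d"])
    moreover have "(U * B) $$ (0,0) = U $$ (0,0) * \<theta>s d"
      unfolding B using U by (simp add: upper_bidiagonal_mult_right)
    ultimately show ?case using \<theta>s_distinct[of 0 d] 0 by (auto simp: mult.commute)
  next
    case (Suc k)
    have "(U * B) $$ (0,Suc k) = \<theta>s 0 * U $$ (0,Suc k)"
      unfolding UB using U Suc.prems by (simp add: mat_diag_mult_left_entry[of _ "Suc d" "Suc d"])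
    moreover have "(U * B) $$ (0,Suc k) = U $$ (0,Suc k) * \<theta>s (d - Suc k)"
      unfolding B using U Suc by (simp add: upper_bidiagonal_mult_right)
    ultimately show ?case using \<theta>s_distinct[of 0 "d - Suc k"] Suc.prems by (auto simp: mult.commute)
  qed
  have NX: "?N * X = X * ?N"
  proof -
    obtain x where x: "X = Q * mat_diag n x * Qi" using commuting_diag[OF X comm] by blast
    show ?thesis
      unfolding x poly_at_mat_diag_conj[OF Q_diag] by (simp only: diag_conj_mult[OF Q_eigen(2,3,5)] mult.commute)
  qed
  have "R\<^sup>T * ?N = R\<^sup>T * (?N * (X * Y))"
    using N by (simp add: XY(1) right_mult_one_mat[of _ "Suc d" "Suc d"])
  also have "\<dots> = R\<^sup>T * ((?N * X) * Y)"
    using N X Y by (simp add: square_assoc)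
  also have "\<dots> = (U * ?N) * Y"
    unfolding NX U_def using P_eigen(3) N X Y by (simp add: square_assoc)
  finally have RN: "R\<^sup>T * ?N = (U * ?N) * Y" .
  have UN: "(U * ?N) $$ (0,k) = (if k = d - i then U $$ (0,d) else 0)" if "k < n" for k
  proof -
    have "(U * ?N) $$ (0,k) = (\<Sum>l<n. U $$ (0,l) * ?N $$ (l,k))"
      by (rule mat_mult_entry[OF U N]) (use that in auto)
    also have "\<dots> = (\<Sum>l\<in>{d}. U $$ (0,l) * ?N $$ (l,k))"
      by (rule sum.mono_neutral_right) (use U0 in auto)
    finally show ?thesis using that i by (simp add: eta_row)
  qed
  have "mat_trace (?N * Es 0) = (\<Sum>k<n. R\<^sup>T $$ (0,k) * ?N $$ (k,0))"
    unfolding trace_mult_Es0[OF N] by (rule sum.cong) (use R_eigen(2) in \<open>auto simp: mult.commute\<close>)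
  also have "\<dots> = ((U * ?N) * Y) $$ (0,0)"
    unfolding RN[symmetric] by (rule mat_mult_entry[OF P_eigen(3) N, symmetric]) auto
  also have "\<dots> = (\<Sum>k<n. (U * ?N) $$ (0,k) * Y $$ (k,0))"
    by (rule mat_mult_entry[OF mult_carrier_mat[OF U N] Y]) auto
  also have "\<dots> = (\<Sum>k\<in>{d-i}. U $$ (0,d) * Y $$ (k,0))"
    by (rule sum.mono_neutral_cong_right) (use i UN in auto)
  finally show ?thesis by (simp add: U_def)
qed

text \<open>
  \<open>Y e\<^sub>0\<close> is a right eigenvector of \<open>B\<close> for \<open>\<theta>s 0\<close>, and \<open>B\<close> carries \<open>phi\<close> on its superdiagonal.
\<close>

lemma Y_column:
  assumes i: "1 \<le> i" "i \<le> d"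
  shows "(\<theta>s 0 - \<theta>s i) * Y $$ (d-i,0) = phi i * Y $$ (d-(i-1),0)"
proof -
  have "Y * As = Y * As * (X * Y)"
    using XY(1) Y P_eigen(1) by (simp add: right_mult_one_mat[of _ "Suc d" "Suc d"])
  also have "\<dots> = Y * (As * X) * Y"
    using X Y P_eigen(1) by (simp add: square_assoc)
  also have "\<dots> = B * Y"
    unfolding XB using mult_inverse_cancel[OF XY(2) Y X, of "B * Y" n] X Y B_carrier by (simp add: square_assoc)
  finally have "(Y * As) $$ (d-i,0) = (B * Y) $$ (d-i,0)" by simp
  moreover have "(Y * As) $$ (d-i,0) = Y $$ (d-i,0) * \<theta>s 0"
    using Y by (simp add: upper_bidiagonal_mult_right)
  moreover have "(B * Y) $$ (d-i,0) = \<theta>s i * Y $$ (d-i,0) + phi i * Y $$ (d-(i-1),0)"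
  proof -
    have "d - (d - i) = i" "d - i + 1 = d - (i - 1)" "d - (d - (i - 1)) + 1 = i" using i by auto
    then show ?thesis unfolding B using Y i by (subst upper_bidiagonal_mult_left) auto
  qed
  ultimately show ?thesis by (simp add: algebra_simps)
qed

text \<open>
  For \<open>i = 0\<close> the trace is \<open>w\<^sub>0 = 1\<close>, so neither the scalar in \<open>w\<^sup>T X\<close> nor the last entry of \<open>Y e\<^sub>0\<close>
  vanishes; the remaining entries inherit this through the recursion, as \<open>phi\<close> has no zero.
\<close>

lemma eta_trace_nonzero:
  assumes "i \<le> d"
  shows "mat_trace (poly_at_mat (eta d \<theta> i) A * Es 0) \<noteq> 0"
proof -
  have "mat_trace (poly_at_mat (eta d \<theta> 0) A * Es 0) = (\<Sum>k\<in>{0}. 1\<^sub>m n $$ (k,0) * R $$ (k,0))"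
    unfolding trace_mult_Es0[OF poly_at_A_carrier]
    by (rule sum.mono_neutral_cong_right) (auto simp: eta_def poly_at_A_one)
  also have "\<dots> = 1" using R_one[of 0] by simp
  finally have c: "(R\<^sup>T * X) $$ (0,d) * Y $$ (d,0) = 1" using eta_trace[of 0] by simp
  have "Y $$ (d-i,0) \<noteq> 0"
    using assms
  proof (induction i)
    case 0
    then show ?case using c by auto
  next
    case (Suc i)
    then show ?case using Y_column[of "Suc i"] phi_nonzero[of "Suc i"] by auto
  qed
  then show ?thesis using c unfolding eta_trace[OF assms] by auto
qed

lemma second_split_seq_eq:
  assumes i: "1 \<le> i" "i \<le> d"
  shows "second_split_seq d (A, E, As, Es) i = phi i"
proof -
  have eta: "eta d (eigenvalue_seq d (A, E, As, Es)) j = eta d \<theta> j" for j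
    unfolding eta_def by (rule prod.cong) (use eigenvalue_seqs in auto)
  let ?t = "\<lambda>j. mat_trace (poly_at_mat (eta d \<theta> j) A * Es 0)"
  have "second_split_seq d (A, E, As, Es) i = (\<theta>s 0 - \<theta>s i) * ?t i / ?t (i-1)"
    unfolding second_split_seq.simps Let_def eta using i eigenvalue_seqs(2) by simp
  moreover have "(\<theta>s 0 - \<theta>s i) * ?t i = phi i * ?t (i-1)"
  proof -
    have "(\<theta>s 0 - \<theta>s i) * ?t i = (R\<^sup>T * X) $$ (0,d) * ((\<theta>s 0 - \<theta>s i) * Y $$ (d-i,0))"
      unfolding eta_trace[OF i(2)] by (simp only: mult_ac)
    also have "\<dots> = phi i * ?t (i-1)"
      unfolding Y_column[OF i] using eta_trace[of "i-1"] i by (simp add: mult_ac)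
    finally show ?thesis .
  qed
  ultimately show ?thesis using eta_trace_nonzero[of "i-1"] i by simp
qed

text \<open>
  \<open>X\<close> commutes with \<open>A\<close>, so \<open>X = \<Sum>\<^sub>r x\<^sub>r E\<^sub>r\<close>; as \<open>Q\<close> is unitriangular, \<open>x\<^sub>r\<close> is the diagonal
  entry \<open>X\<^sub>r\<^sub>r\<close>. Comparing the superdiagonals in \<open>As X = X B\<close>, where \<open>X\<close> is lower triangular, gives
  \<open>vphi\<^sub>r x\<^sub>r = x\<^sub>r\<^sub>-\<^sub>1 phi\<^sub>d\<^sub>-\<^sub>r\<^sub>+\<^sub>1\<close>: the coefficients of the switching element.
\<close>

lemma X_eq_switching_element: "X = X $$ (0,0) \<cdot>\<^sub>m switching_element d (A, E, As, Es)"
proof -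
  define x where "x = (\<lambda>k. (Qi * X * Q) $$ (k,k))"
  have X_x: "X = Q * mat_diag n x * Qi"
    unfolding x_def by (rule commuting_diag[OF X comm])
  have lowQ: "\<And>i j. i < j \<Longrightarrow> j < n \<Longrightarrow> Q $$ (i,j) = 0" using Q_low by simp
  have Qi_low: "\<And>i j. i < j \<Longrightarrow> j < n \<Longrightarrow> Qi $$ (i,j) = 0"
  proof -
    fix i j assume ij: "i < j" "j < n"
    show "Qi $$ (i,j) = 0"
      by (rule lower_triangular_solve(1)[OF Q_eigen(2,3) lowQ, of j j]) (use ij Q_eigen(4) Q_one in auto)
  qed
  have QD: "Q * mat_diag n x \<in> carrier_mat n n" using Q_eigen(2) by (simp add: square_assoc)
  have QD_entry: "(Q * mat_diag n x) $$ (i,j) = Q $$ (i,j) * x j" if "i < n" "j < n" for i j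
    using that Q_eigen(2) by (simp add: mat_diag_mult_right_entry[of _ "Suc d" "Suc d"])
  have QD_low: "\<And>i j. i < j \<Longrightarrow> j < n \<Longrightarrow> (Q * mat_diag n x) $$ (i,j) = 0"
    using QD_entry lowQ by simp
  have X_low: "X $$ (i,j) = 0" if "i < j" "j < n" for i j
    unfolding X_x by (rule lower_triangular_mult(1)[OF QD Q_eigen(3) QD_low Qi_low]) (use that in auto)
  have "Qi $$ (i,i) = 1" if "i < n" for i
    using lower_triangular_mult(2)[OF Q_eigen(2,3) lowQ Qi_low that] that Q_one[of i] by (simp add: Q_eigen(4))
  then have X_diag: "X $$ (i,i) = x i" if "i < n" for i
    unfolding X_x
    using lower_triangular_mult(2)[OF QD Q_eigen(3) QD_low Qi_low that] that QD_entry[of i i] Q_one[of i]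
    by simp
  have step: "vphi (Suc i) * x (Suc i) = x i * phi (d - i)" if "Suc i \<le> d" for i
  proof -
    have "(As * X) $$ (i, Suc i) = vphi (Suc i) * x (Suc i)"
      using X that X_low[of i "Suc i"] X_diag[of "Suc i"] by (simp add: upper_bidiagonal_mult_left)
    moreover have "(X * B) $$ (i, Suc i) = x i * phi (d - i)"
      unfolding B using X that X_low[of i "Suc i"] X_diag[of i]
      by (simp add: upper_bidiagonal_mult_right Suc_diff_Suc)
    ultimately show ?thesis by (simp add: XB)
  qed
  have x: "x i = x 0 * ((\<Prod>h=1..i. phi (d - h + 1)) / (\<Prod>h=1..i. vphi h))" if "i \<le> d" for i
    using that
  proof (induction i)
    case (Suc i)
    have "d - Suc i + 1 = d - i" using Suc.prems by simp
    moreover have "x (Suc i) = x i * phi (d - i) / vphi (Suc i)"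
      using step[of i] vphi_nonzero[of "Suc i"] Suc.prems by (simp add: eq_divide_eq mult.commute)
    ultimately show ?case using Suc by (simp add: mult_ac)
  qed simp
  define c where "c = (\<lambda>r. (\<Prod>h=1..r. second_split_seq d (A, E, As, Es) (d - h + 1)) /
    (\<Prod>h=1..r. first_split_seq d (A, E, As, Es) h))"
  have c: "x r = x 0 * c r" if "r \<le> d" for r
  proof -
    have "(\<Prod>h=1..r. second_split_seq d (A, E, As, Es) (d - h + 1)) = (\<Prod>h=1..r. phi (d - h + 1))"
      by (rule prod.cong[OF refl], rule second_split_seq_eq) (use that in auto)
    moreover have "(\<Prod>h=1..r. first_split_seq d (A, E, As, Es) h) = (\<Prod>h=1..r. vphi h)"
      by (rule prod.cong[OF refl], rule first_split_seq_eq) (use that in auto)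
    ultimately show ?thesis using x[OF that] by (simp only: c_def)
  qed
  have S: "switching_element d (A, E, As, Es) = mat_lincomb n c E {..d}"
    by (simp add: c_def Let_def)
  have E_entry: "E r $$ (i,j) = Q $$ (i,r) * Qi $$ (r,j)" if "r \<le> d" "i < n" "j < n" for r i j
  proof -
    have "E r $$ (i,j) = (\<Sum>k<n. Q $$ (i,k) * (if k = r then 1 else 0) * Qi $$ (k,j))"
      using that diag_conj_entry[OF Q_eigen(2,3), of i j] by (simp add: E primitive_idempotents)
    also have "\<dots> = (\<Sum>k\<in>{r}. Q $$ (i,k) * Qi $$ (k,j))"
      by (rule sum.mono_neutral_cong_right) (use that in auto)
    finally show ?thesis by simp
  qed
  show ?thesis
    unfolding S
  proof (rule eq_matI)
    fix i j assume "i < dim_row (X $$ (0,0) \<cdot>\<^sub>m mat_lincomb n c E {..d})"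
      "j < dim_col (X $$ (0,0) \<cdot>\<^sub>m mat_lincomb n c E {..d})"
    then have ij: "i < n" "j < n" by (simp_all add: mat_lincomb_def)
    have "X $$ (i,j) = (\<Sum>k<n. Q $$ (i,k) * x k * Qi $$ (k,j))"
      unfolding X_x by (rule diag_conj_entry[OF Q_eigen(2,3) ij])
    also have "\<dots> = (\<Sum>k\<le>d. x 0 * (c k * E k $$ (i,j)))"
    proof (rule sum.cong)
      fix k assume "k \<in> {..d}"
      then have k: "k \<le> d" by simp
      show "Q $$ (i,k) * x k * Qi $$ (k,j) = x 0 * (c k * E k $$ (i,j))"
        unfolding c[OF k] E_entry[OF k ij] by simp
    qed auto
    finally show "X $$ (i,j) = (X $$ (0,0) \<cdot>\<^sub>m mat_lincomb n c E {..d}) $$ (i,j)"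
      using ij X_diag[of 0] by (simp add: mat_lincomb_def sum_distrib_left)
  qed (use X in \<open>simp_all add: mat_lincomb_def\<close>)
qed

end

end

end

theorem theorem14p1:
  fixes d :: nat
    and \<theta> \<theta>s vphi :: "nat \<Rightarrow> 'a::field"
    and A As :: "'a mat"
    and E Es :: "nat \<Rightarrow> 'a mat"
  assumes "\<And>i j. i \<le> d \<Longrightarrow> j \<le> d \<Longrightarrow> i \<noteq> j \<Longrightarrow> \<theta> i \<noteq> \<theta> j"
    and "\<And>i j. i \<le> d \<Longrightarrow> j \<le> d \<Longrightarrow> i \<noteq> j \<Longrightarrow> \<theta>s i \<noteq> \<theta>s j"
    and "\<And>i. 1 \<le> i \<Longrightarrow> i \<le> d \<Longrightarrow> vphi i \<noteq> 0"
    and "A = lower_bidiagonal d \<theta>"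
    and "As = upper_bidiagonal d \<theta>s vphi"
    and "\<And>i. i \<le> d \<Longrightarrow> E i = primitive_idempotent d A \<theta> i"
    and "\<And>i. i \<le> d \<Longrightarrow> Es i = primitive_idempotent d As \<theta>s i"
  shows "(leonard_pair d A As \<longleftrightarrow> (\<exists>X phi. reverses_bidiagonal d A As \<theta>s X phi)) \<and>
    (\<forall>X phi. leonard_pair d A As \<and> reverses_bidiagonal d A As \<theta>s X phi \<longrightarrow>
       leonard_system d (A, E, As, Es) \<and>
       (\<forall>i\<in>{1..d}. phi i = second_split_seq d (A, E, As, Es) i) \<and>
       (\<exists>c. X = c \<cdot>\<^sub>m switching_element d (A, E, As, Es)))"
proof -
  obtain Q Qi where Q: "similar_mat_wit (lower_bidiagonal d \<theta>) (mat_diag (d+1) \<theta>) Q Qi"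
    "\<And>i j. i < j \<Longrightarrow> j \<le> d \<Longrightarrow> Q $$ (i,j) = 0" "\<And>i. i \<le> d \<Longrightarrow> Q $$ (i,i) = 1"
    using bidiagonal_eigenmatrix[of d \<theta> "\<lambda>_. 1"] assms(1) unfolding lower_bidiagonal_eq_transpose by metis
  obtain R Ri where R: "similar_mat_wit ((upper_bidiagonal d \<theta>s vphi)\<^sup>T) (mat_diag (d+1) \<theta>s) R Ri"
    "\<And>i j. i < j \<Longrightarrow> j \<le> d \<Longrightarrow> R $$ (i,j) = 0" "\<And>i. i \<le> d \<Longrightarrow> R $$ (i,i) = 1"
    using bidiagonal_eigenmatrix[of d \<theta>s vphi] assms(2) by metis
  interpret split_pair d \<theta> \<theta>s vphi Q Qi R Ri
    by unfold_locales (fact assms Q R)+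
  have rev: "leonard_system d (A, E, As, Es) \<and>
       (\<forall>i\<in>{1..d}. phi i = second_split_seq d (A, E, As, Es) i) \<and>
       (\<exists>c. X = c \<cdot>\<^sub>m switching_element d (A, E, As, Es))"
    if X: "reverses_bidiagonal d A As \<theta>s X phi" for X phi
  proof -
    define B where "B = upper_bidiagonal d (\<lambda>i. \<theta>s (d - i)) (\<lambda>i. phi (d - i + 1))"
    have B_carrier: "B \<in> carrier_mat (d+1) (d+1)" by (simp add: B_def)
    obtain Y where X': "X \<in> carrier_mat (d+1) (d+1)" and Y: "Y \<in> carrier_mat (d+1) (d+1)"
      and XY: "X * Y = 1\<^sub>m (d+1)" "Y * X = 1\<^sub>m (d+1)"
      and YA: "Y * A * X = A" and YB: "Y * As * X = B" and phi: "\<And>i. i \<in> {1..d} \<Longrightarrow> phi i \<noteq> 0"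
      using X by (auto simp: reverses_bidiagonal_def inverts_mat_def B_def)
    have cancel: "X * (Y * M * X) = M * X" if "M \<in> carrier_mat (d+1) (d+1)" for M
      using mult_inverse_cancel[OF XY(1) X' Y, of "M * X" "d+1"] X' Y that by (simp add: square_assoc)
    have comm: "X * lower_bidiagonal d \<theta> = lower_bidiagonal d \<theta> * X"
      using cancel[of A] YA assms(4) Q_eigen(1) by simp
    have XB: "upper_bidiagonal d \<theta>s vphi * X = X * B"
      using cancel[of As] YB assms(5) P_eigen(1) by simp
    have EE: "\<And>i. i \<le> d \<Longrightarrow> E i = primitive_idempotent d (lower_bidiagonal d \<theta>) \<theta> i"
      "\<And>i. i \<le> d \<Longrightarrow> Es i = primitive_idempotent d (upper_bidiagonal d \<theta>s vphi) \<theta>s i"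
      using assms(4-7) by auto
    have phi': "\<And>i. 1 \<le> i \<Longrightarrow> i \<le> d \<Longrightarrow> phi i \<noteq> 0" using phi by simp
    have T: "irreducible_tridiagonal (d+1) T"
      using irreducible_T_of_reverses X assms(4,5) by simp
    show ?thesis
      unfolding assms(4,5)
      using leonard_system_of_irreducible_T[OF EE T]
        second_split_seq_eq[OF EE X' Y XY comm B_def XB phi']
        X_eq_switching_element[OF EE X' Y XY comm B_def XB phi'] by (auto intro!: exI)
  qed
  have "leonard_pair d A As \<longleftrightarrow> (\<exists>X phi. reverses_bidiagonal d A As \<theta>s X phi)"
    unfolding assms(4,5)
    using irreducible_T_of_leonard_pair ex_reverses_of_irreducible_T
      irreducible_T_of_reverses leonard_pair_of_irreducible_T by blast
  with rev show ?thesis by blast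
qed

end
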